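(* Let $0<s<1$ and $\sigma>0$. The following quantities (mass, momentum, energy) are conserved in time by sufficiently smooth and sufficiently decaying (as $|x|\to\infty$) solutions $u=v+iw$ ($v,w$ real-valued) of $$iu_t-(-\partial_{xx})^s u+|u|^{2\sigma}u=0,\qquad x\in\mathbb{R},\ t>0:$$ $$I_1(v,w)=\frac12\int_{\mathbb{R}}(v^2+w^2)\,dx=\frac12\int_{\mathbb{R}}|u|^2\,dx,$$ $$I_2(v,w)=\frac12\int_{\mathbb{R}}(vw_x-wv_x)\,dx=\frac12\int_{\mathbb{R}}\mathrm{Im}(\overline{u}\,u_x)\,dx,$$ $$H(v,w)=\int_{\mathbb{R}}\left(\frac12\left((|D|^s v)^2+(|D|^s w)^2\right)-\frac{1}{2\sigma+2}(v^2+w^2)^{\sigma+1}\right)dx.$$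
   Context: The Fourier transform is $\widehat f(\xi)=\int_{\mathbb{R}}f(x)e^{-i\xi x}\,dx$. The operators $(-\partial_{xx})^s$ and $|D|^s$ are the Fourier multipliers $\widehat{(-\partial_{xx})^s f}(\xi)=|\xi|^{2s}\widehat f(\xi)$ and $\widehat{|D|^s f}(\xi)=|\xi|^s\widehat f(\xi)$, $\xi\in\mathbb{R}$. In terms of the real and imaginary parts of $u=v+iw$, the equation is the real system $v_t-(-\partial_{xx})^s w+(v^2+w^2)^\sigma w=0$, $-w_t-(-\partial_{xx})^s v+(v^2+w^2)^\sigma v=0$. *)

theory Defs
  imports "HOL-Probability.Probability"
begin

definition fourier :: "(real \<Rightarrow> complex) \<Rightarrow> real \<Rightarrow> complex" where
  "fourier f \<xi> = (LINT x|lborel. f x * iexp (- (\<xi> * x)))"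

text \<open>The operator with symbol \<open>m\<close>, that is, the inverse transform of \<open>m\<close> times the transform
  of \<open>f\<close>. Lemma \<open>fourier_fourier_multiplier\<close> below recovers the defining identity
  of a Fourier multiplier.\<close>

definition fourier_multiplier :: "(real \<Rightarrow> real) \<Rightarrow> (real \<Rightarrow> complex) \<Rightarrow> real \<Rightarrow> complex" where
  "fourier_multiplier m f x =
     1 / (2 * pi) * (LINT \<xi>|lborel. m \<xi> * fourier f \<xi> * iexp (\<xi> * x))"

definition frac_laplacian :: "real \<Rightarrow> (real \<Rightarrow> complex) \<Rightarrow> real \<Rightarrow> complex" where
  "frac_laplacian s f = fourier_multiplier (\<lambda>\<xi>. \<bar>\<xi>\<bar> powr (2 * s)) f"

text \<open>\<open>|D|\<^sup>s\<close> on real-valued functions. The symbol is even, so the multiplier maps real functions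
  to real functions and \<open>Re\<close> is only a coercion; see \<open>of_real_abs_D\<close>.\<close>

definition abs_D :: "real \<Rightarrow> (real \<Rightarrow> real) \<Rightarrow> real \<Rightarrow> real" where
  "abs_D s v x = Re (fourier_multiplier (\<lambda>\<xi>. \<bar>\<xi>\<bar> powr s) (\<lambda>y. complex_of_real (v y)) x)"

lemma lborel_integral_minus:
  fixes f :: "real \<Rightarrow> complex"
  shows "(LINT x|lborel. f (- x)) = (LINT x|lborel. f x)"
  using lborel_integral_real_affine[of "-1" f 0] by simp

lemma fourier_of_real_minus:
  "fourier (\<lambda>y. complex_of_real (v y)) (- \<xi>) = cnj (fourier (\<lambda>y. complex_of_real (v y)) \<xi>)"
  unfolding fourier_def by (simp add: Bochner_Integration.integral_cnj[symmetric] del: Bochner_Integration.integral_cnj add: exp_cnj)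

lemma of_real_abs_D:
  "complex_of_real (abs_D s v x) =
     fourier_multiplier (\<lambda>\<xi>. \<bar>\<xi>\<bar> powr s) (\<lambda>y. complex_of_real (v y)) x"
proof -
  let ?f = "\<lambda>y. complex_of_real (v y)"
  let ?h = "\<lambda>\<xi>. complex_of_real (\<bar>\<xi>\<bar> powr s) * fourier ?f \<xi> * iexp (\<xi> * x)"
  have "cnj (LINT \<xi>|lborel. ?h \<xi>) = (LINT \<xi>|lborel. ?h (- \<xi>))"
    by (simp add: Bochner_Integration.integral_cnj[symmetric] del: Bochner_Integration.integral_cnj add: fourier_of_real_minus exp_cnj)
  also have "\<dots> = (LINT \<xi>|lborel. ?h \<xi>)"
    by (rule lborel_integral_minus)
  finally have "cnj (fourier_multiplier (\<lambda>\<xi>. \<bar>\<xi>\<bar> powr s) ?f x) =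
      fourier_multiplier (\<lambda>\<xi>. \<bar>\<xi>\<bar> powr s) ?f x"
    unfolding fourier_multiplier_def by simp
  then show ?thesis
    unfolding abs_D_def by (metis Reals_cnj_iff of_real_Re)
qed

lemma gaussian_fourier:
  fixes a :: real assumes n: "n > 0"
  shows "(LINT x|lborel. iexp (a * x) * complex_of_real (std_normal_density (x / n))) =
    complex_of_real (n * exp (- ((a * n)\<^sup>2) / 2))"
proof -
  have "(LINT x|lborel. iexp (a * x) * complex_of_real (std_normal_density (x / n))) =
     n * (LINT x|lborel. iexp (a * (n * x)) * complex_of_real (std_normal_density x))"
    using lborel_integral_real_affine[of n "\<lambda>x. iexp (a * x) * complex_of_real (std_normal_density (x / n))" 0] n
    by (simp add: scaleR_conv_of_real)
  also have "(LINT x|lborel. iexp (a * (n * x)) * complex_of_real (std_normal_density x))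
      = char std_normal_distribution (a * n)"
    unfolding char_def
    by (subst integral_density) (auto simp: scaleR_conv_of_real mult_ac)
  also have "\<dots> = complex_of_real (exp (- ((a * n)\<^sup>2) / 2))"
    by (simp add: char_std_normal_distribution)
  finally show ?thesis by simp
qed

lemma fourier_inversion:
  fixes \<phi> g :: "real \<Rightarrow> complex"
  assumes phi: "integrable lborel \<phi>" and bdd: "\<And>\<eta>. norm (\<phi> \<eta>) \<le> B" and cont: "isCont \<phi> \<xi>"
    and g: "\<And>x. g x = 1 / (2 * pi) * (LINT \<eta>|lborel. \<phi> \<eta> * iexp (\<eta> * x))"
    and gint: "integrable lborel g"
  shows "fourier g \<xi> = \<phi> \<xi>"
proof -
  define r where "r n = real (Suc n)" for n
  have r: "r n > 0" for n by (simp add: r_def)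
  have rlim: "(\<lambda>n. x / r n) \<longlonglongrightarrow> 0" for x
    unfolding r_def by (rule LIMSEQ_Suc) (rule lim_const_over_n)
  have [measurable]: "\<phi> \<in> borel_measurable borel" "g \<in> borel_measurable borel"
    using phi gint by auto
  define c where "c = 1 / sqrt (2 * pi)"
  have c: "c > 0" by (simp add: c_def)
  have c2: "c * c * (2 * pi) = 1" by (simp add: c_def field_simps)
  define A where "A n = (LINT x|lborel. g x * iexp (- (\<xi> * x)) * complex_of_real (std_normal_density (x / r n)))" for n
  have dens_le: "std_normal_density x \<le> c" for x
    unfolding std_normal_density_def c_def by (simp add: divide_simps)
  have "A \<longlonglongrightarrow> (LINT x|lborel. g x * iexp (- (\<xi> * x)) * complex_of_real c)"
    unfolding A_def
  proof (rule integral_dominated_convergence[where w = "\<lambda>x. norm (g x) * c"])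
    show "integrable lborel (\<lambda>x. norm (g x) * c)" using gint by auto
    show "AE x in lborel. (\<lambda>i. g x * iexp (- (\<xi> * x)) * complex_of_real (std_normal_density (x / r i)))
         \<longlonglongrightarrow> g x * iexp (- (\<xi> * x)) * complex_of_real c"
    proof (rule AE_I2)
      fix x
      have "(\<lambda>i. std_normal_density (x / r i)) \<longlonglongrightarrow> 1 / sqrt (2 * pi) * exp (- 0\<^sup>2 / 2)"
        unfolding std_normal_density_def by (intro tendsto_intros rlim) auto
      then have "(\<lambda>i. std_normal_density (x / r i)) \<longlonglongrightarrow> c" by (simp add: c_def)
      then show "(\<lambda>i. g x * iexp (- (\<xi> * x)) * complex_of_real (std_normal_density (x / r i)))
         \<longlonglongrightarrow> g x * iexp (- (\<xi> * x)) * complex_of_real c"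
        by (intro tendsto_intros)
    qed
    show "AE x in lborel. norm (g x * iexp (- (\<xi> * x)) * complex_of_real (std_normal_density (x / r i))) \<le> norm (g x) * c" for i
      using dens_le by (auto simp: norm_mult normal_density_nonneg mult_left_mono)
  qed measurable
  then have lim1: "A \<longlonglongrightarrow> fourier g \<xi> * c"
    by (simp add: fourier_def)
  have A_eq: "A n = complex_of_real c * (LINT z|lborel. \<phi> (\<xi> + z / r n) * complex_of_real (std_normal_density z))" for n
  proof -
    let ?k = "\<lambda>x \<eta>. \<phi> \<eta> * complex_of_real (std_normal_density (x / r n)) * iexp ((\<eta> - \<xi>) * x)"
    have dint: "integrable lborel (\<lambda>x. std_normal_density (x / r n))"
      using lborel_integrable_real_affine[of "std_normal_density" "1 / r n" 0] r[of n] by simp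
    have "integrable (lborel \<Otimes>\<^sub>M lborel) (\<lambda>(x, \<eta>). ?k x \<eta>)"
    proof (rule lborel_pair.Fubini_integrable)
      show "(\<lambda>(x, \<eta>). ?k x \<eta>) \<in> borel_measurable (lborel \<Otimes>\<^sub>M lborel)" by measurable
      have "(LINT y|lborel. norm (case (x, y) of (x, \<eta>) \<Rightarrow> ?k x \<eta>))
          = std_normal_density (x / r n) * (LINT y|lborel. norm (\<phi> y))" for x
        by (simp add: norm_mult normal_density_nonneg mult.commute)
      then show "integrable lborel (\<lambda>x. LINT y|lborel. norm (case (x, y) of (x, \<eta>) \<Rightarrow> ?k x \<eta>))"
        using dint by simp
      have "integrable lborel (\<lambda>\<eta>. ?k x \<eta>)" for x
        by (rule Bochner_Integration.integrable_bound[where f = "\<lambda>\<eta>. \<phi> \<eta> * complex_of_real (std_normal_density (x / r n))"])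
          (use phi in \<open>auto simp: norm_mult\<close>)
      then show "AE x in lborel. integrable lborel (\<lambda>y. case (x, y) of (x, \<eta>) \<Rightarrow> ?k x \<eta>)" by simp
    qed
    then have fub: "(LINT \<eta>|lborel. (LINT x|lborel. ?k x \<eta>)) = (LINT x|lborel. (LINT \<eta>|lborel. ?k x \<eta>))"
      by (rule lborel_pair.Fubini_integral)
    have "g x * iexp (- (\<xi> * x)) * complex_of_real (std_normal_density (x / r n))
        = 1 / (2 * pi) * (LINT \<eta>|lborel. ?k x \<eta>)" for x
    proof -
      have "(LINT \<eta>|lborel. ?k x \<eta>) = (LINT \<eta>|lborel. (\<phi> \<eta> * iexp (\<eta> * x)) *
          (iexp (- (\<xi> * x)) * complex_of_real (std_normal_density (x / r n))))"
        by (rule Bochner_Integration.integral_cong)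
          (auto simp: algebra_simps exp_add[symmetric] exp_diff exp_minus field_simps)
      also have "\<dots> = (LINT \<eta>|lborel. \<phi> \<eta> * iexp (\<eta> * x)) *
          (iexp (- (\<xi> * x)) * complex_of_real (std_normal_density (x / r n)))"
        by (rule integral_mult_left_zero)
      finally show ?thesis unfolding g by simp
    qed
    then have A1: "A n = 1 / (2 * pi) * (LINT x|lborel. (LINT \<eta>|lborel. ?k x \<eta>))"
      unfolding A_def by simp
    let ?q = "\<lambda>\<eta>. \<phi> \<eta> * complex_of_real (r n * exp (- (((\<eta> - \<xi>) * r n)\<^sup>2) / 2))"
    have inner: "(LINT x|lborel. ?k x \<eta>) = ?q \<eta>" for \<eta>
    proof -
      have "(LINT x|lborel. ?k x \<eta>) = (LINT x|lborel. \<phi> \<eta> * (iexp ((\<eta> - \<xi>) * x) * complex_of_real (std_normal_density (x / r n))))"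
        by (simp only: mult_ac)
      also have "\<dots> = \<phi> \<eta> * (LINT x|lborel. iexp ((\<eta> - \<xi>) * x) * complex_of_real (std_normal_density (x / r n)))"
        by (rule integral_mult_right_zero)
      finally show ?thesis by (simp only: gaussian_fourier[OF r])
    qed
    have fin: "complex_of_real (1 / (2 * pi)) * ((1 / r n) *\<^sub>R (complex_of_real (r n / c) * X)) = complex_of_real c * X" for X
    proof -
      have "1 / (2 * pi) * (1 / r n * (r n / c)) = c"
        using c r[of n] c2 by (simp add: divide_simps mult_ac)
      then have "complex_of_real (1 / (2 * pi) * (1 / r n * (r n / c))) * X = complex_of_real c * X" by simp
      then show ?thesis by (simp only: scaleR_conv_of_real of_real_mult of_real_divide mult.assoc)
    qed
    have "A n = complex_of_real (1 / (2 * pi)) * (LINT \<eta>|lborel. (LINT x|lborel. ?k x \<eta>))"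
      by (simp only: A1 fub)
    also have "\<dots> = complex_of_real (1 / (2 * pi)) * (LINT \<eta>|lborel. ?q \<eta>)"
      by (simp only: inner)
    also have "(LINT \<eta>|lborel. ?q \<eta>)
       = (1 / r n) *\<^sub>R (LINT z|lborel. \<phi> (\<xi> + z / r n) * complex_of_real (r n * exp (- z\<^sup>2 / 2)))"
      using lborel_integral_real_affine[of "1 / r n" "\<lambda>\<eta>. \<phi> \<eta> * complex_of_real (r n * exp (- (((\<eta> - \<xi>) * r n)\<^sup>2) / 2))" \<xi>] r[of n]
      by simp
    also have "(LINT z|lborel. \<phi> (\<xi> + z / r n) * complex_of_real (r n * exp (- z\<^sup>2 / 2)))
       = (LINT z|lborel. complex_of_real (r n / c) * (\<phi> (\<xi> + z / r n) * complex_of_real (std_normal_density z)))"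
      using c by (intro Bochner_Integration.integral_cong refl) (simp add: std_normal_density_def c_def)
    also have "\<dots> = complex_of_real (r n / c) * (LINT z|lborel. \<phi> (\<xi> + z / r n) * complex_of_real (std_normal_density z))"
      by (rule integral_mult_right_zero)
    also note fin
    finally show ?thesis .
  qed
  have "(\<lambda>n. LINT z|lborel. \<phi> (\<xi> + z / r n) * complex_of_real (std_normal_density z))
     \<longlonglongrightarrow> (LINT z|lborel. \<phi> \<xi> * complex_of_real (std_normal_density z))"
  proof (rule integral_dominated_convergence[where w = "\<lambda>z. B * std_normal_density z"])
    show "integrable lborel (\<lambda>z. B * std_normal_density z)" by simp
    show "AE z in lborel. (\<lambda>i. \<phi> (\<xi> + z / r i) * complex_of_real (std_normal_density z))
       \<longlonglongrightarrow> \<phi> \<xi> * complex_of_real (std_normal_density z)"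
    proof (rule AE_I2)
      fix z
      have "(\<lambda>i. \<xi> + z / r i) \<longlonglongrightarrow> \<xi> + 0" by (intro tendsto_intros rlim)
      then have "(\<lambda>i. \<phi> (\<xi> + z / r i)) \<longlonglongrightarrow> \<phi> \<xi>"
        using isCont_tendsto_compose[OF cont] by simp
      then show "(\<lambda>i. \<phi> (\<xi> + z / r i) * complex_of_real (std_normal_density z))
       \<longlonglongrightarrow> \<phi> \<xi> * complex_of_real (std_normal_density z)" by (intro tendsto_intros)
    qed
    show "AE z in lborel. norm (\<phi> (\<xi> + z / r i) * complex_of_real (std_normal_density z)) \<le> B * std_normal_density z" for i
      using bdd by (auto simp: norm_mult normal_density_nonneg mult_right_mono)
  qed measurable
  moreover have "(LINT z|lborel. \<phi> \<xi> * complex_of_real (std_normal_density z)) = \<phi> \<xi>"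
    by simp
  ultimately have "A \<longlonglongrightarrow> complex_of_real c * \<phi> \<xi>"
    unfolding A_eq by (auto intro: tendsto_intros)
  with lim1 have "fourier g \<xi> * c = complex_of_real c * \<phi> \<xi>"
    by (rule LIMSEQ_unique)
  then show ?thesis using c by simp
qed

lemma fourier_fourier_multiplier:
  assumes "integrable lborel (\<lambda>\<xi>. m \<xi> * fourier f \<xi>)"
    and "\<And>\<xi>. norm (m \<xi> * fourier f \<xi>) \<le> B"
    and "isCont (\<lambda>\<xi>. m \<xi> * fourier f \<xi>) \<xi>"
    and "integrable lborel (fourier_multiplier m f)"
  shows "fourier (fourier_multiplier m f) \<xi> = m \<xi> * fourier f \<xi>"
  by (rule fourier_inversion[OF assms(1-3) _ assms(4)]) (simp add: fourier_multiplier_def)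

text \<open>Functions of time and space are curried as \<open>u t x\<close>.\<close>

definition dt :: "(real \<Rightarrow> real \<Rightarrow> complex) \<Rightarrow> real \<Rightarrow> real \<Rightarrow> complex" where
  "dt u t x = vector_derivative (\<lambda>\<tau>. u \<tau> x) (at t)"

definition dx :: "(real \<Rightarrow> real \<Rightarrow> complex) \<Rightarrow> real \<Rightarrow> real \<Rightarrow> complex" where
  "dx u t x = vector_derivative (u t) (at x)"

definition fnls_solution :: "real \<Rightarrow> real \<Rightarrow> (real \<Rightarrow> real \<Rightarrow> complex) \<Rightarrow> bool" where
  "fnls_solution s \<sigma> u \<longleftrightarrow>
     (\<forall>t>0. \<forall>x. \<i> * dt u t x - frac_laplacian s (u t) x
        + complex_of_real (cmod (u t x) powr (2 * \<sigma>)) * u t x = 0)"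

text \<open>The precise meaning given to ``sufficiently smooth'': once differentiable in time and three
  times continuously differentiable in space. Together with the decay below, three derivatives
  make \<open>|\<xi>|\<^bsup>2s\<^esup>\<close> times the transform of \<open>u t\<close> integrable for every \<open>s < 1\<close>.\<close>

definition sufficiently_smooth :: "(real \<Rightarrow> real \<Rightarrow> complex) \<Rightarrow> bool" where
  "sufficiently_smooth u \<longleftrightarrow>
     (\<forall>t>0. \<forall>x. (\<lambda>\<tau>. u \<tau> x) differentiable (at t)) \<and>
     (\<forall>t>0. \<forall>k<3. \<forall>x. (dx ^^ k) u t differentiable (at x)) \<and>
     (\<forall>t>0. continuous_on UNIV ((dx ^^ 3) u t))"

text \<open>Only algebraic decay with some exponent above 1 is asked for: because the symbol
  \<open>|\<xi>|\<^bsup>2s\<^esup>\<close> is not smooth at 0, solutions such as solitary waves typically decay no faster than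
  \<open>|x|\<^bsup>-(1+2s)\<^esup>\<close>, so a Schwartz-type condition would exclude them.\<close>

definition decays_on :: "real set \<Rightarrow> (real \<Rightarrow> real \<Rightarrow> complex) \<Rightarrow> bool" where
  "decays_on J f \<longleftrightarrow>
     (\<exists>C. \<exists>\<delta>>0. \<forall>t\<in>J. \<forall>x. cmod (f t x) \<le> C * (1 + \<bar>x\<bar>) powr (- (1 + \<delta>)))"

definition sufficiently_decaying :: "(real \<Rightarrow> real \<Rightarrow> complex) \<Rightarrow> bool" where
  "sufficiently_decaying u \<longleftrightarrow>
     (\<forall>a b. 0 < a \<and> a < b \<longrightarrow>
        decays_on {a..b} (dt u) \<and> (\<forall>k\<le>3. decays_on {a..b} ((dx ^^ k) u)))"

definition mass_density :: "(real \<Rightarrow> real) \<Rightarrow> (real \<Rightarrow> real) \<Rightarrow> real \<Rightarrow> real" where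
  "mass_density v w x = (v x)\<^sup>2 + (w x)\<^sup>2"

definition momentum_density :: "(real \<Rightarrow> real) \<Rightarrow> (real \<Rightarrow> real) \<Rightarrow> real \<Rightarrow> real" where
  "momentum_density v w x = v x * deriv w x - w x * deriv v x"

definition energy_density ::
    "real \<Rightarrow> real \<Rightarrow> (real \<Rightarrow> real) \<Rightarrow> (real \<Rightarrow> real) \<Rightarrow> real \<Rightarrow> real" where
  "energy_density s \<sigma> v w x =
     1 / 2 * ((abs_D s v x)\<^sup>2 + (abs_D s w x)\<^sup>2)
       - 1 / (2 * \<sigma> + 2) * ((v x)\<^sup>2 + (w x)\<^sup>2) powr (\<sigma> + 1)"

definition mass :: "(real \<Rightarrow> real) \<Rightarrow> (real \<Rightarrow> real) \<Rightarrow> real" where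
  "mass v w = 1 / 2 * (LINT x|lborel. mass_density v w x)"

definition momentum :: "(real \<Rightarrow> real) \<Rightarrow> (real \<Rightarrow> real) \<Rightarrow> real" where
  "momentum v w = 1 / 2 * (LINT x|lborel. momentum_density v w x)"

definition energy :: "real \<Rightarrow> real \<Rightarrow> (real \<Rightarrow> real) \<Rightarrow> (real \<Rightarrow> real) \<Rightarrow> real" where
  "energy s \<sigma> v w = (LINT x|lborel. energy_density s \<sigma> v w x)"

end

theory Submission
  imports Defs
begin

text \<open>
Let \<open>N = |u|\<^sup>2\<^sup>\<sigma> u\<close> be the nonlinearity, let \<open>U\<close> and \<open>V\<close> be the spatial Fourier transforms of
\<open>u\<close> and \<open>N\<close>, and let \<open>m\<close> be a real symbol. The conserved quantities are expressed through the spectral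
integrals \<open>S\<^sub>m(t) = \<integral> m(\<xi>) |U(t, \<xi>)|\<^sup>2 d\<xi>\<close>: up to constants, the mass is \<open>S\<^sub>m\<close> for \<open>m = 1\<close>, the
momentum is \<open>S\<^sub>m\<close> for \<open>m = \<xi>\<close>, and the kinetic part of the energy is \<open>S\<^sub>m\<close> for \<open>m = |\<xi>|\<^sup>2\<^sup>s\<close>
(\<open>integrable_norm_square\<close>, \<open>momentum_spectral\<close>, \<open>kinetic_spectral\<close>). On the frequency side the
equation reads \<open>U\<^sub>t = \<i> (V - |\<xi>|\<^sup>2\<^sup>s U)\<close>, and its linear part rotates \<open>U\<close> without
changing its modulus. Hence, with \<open>m(D)\<close> the multiplier with symbol \<open>m\<close> and Parseval's identity,
\<open>S\<^sub>m' = 4 \<pi> Im \<integral> (m(D) u) cnj N dx\<close> (\<open>spectral_derivative\<close>), and each symbol is inspected in turn.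

For \<open>m = 1\<close> the integrand \<open>u cnj N\<close> is real. For \<open>m = \<xi>\<close> the operator \<open>m(D)\<close> is \<open>- \<i> \<partial>\<^sub>x\<close> and the
imaginary part of the integrand is a multiple of \<open>\<partial>\<^sub>x |u|\<^sup>2\<^sup>\<sigma>\<^sup>+\<^sup>2\<close>. For \<open>m = |\<xi>|\<^sup>2\<^sup>s\<close> the equation gives
\<open>m(D) u = \<i> u\<^sub>t + N\<close>, so the imaginary part is \<open>Re (u\<^sub>t cnj N)\<close>, whose integral is the time
derivative of \<open>\<integral> |u|\<^sup>2\<^sup>\<sigma>\<^sup>+\<^sup>2 dx / (2 \<sigma> + 2)\<close>, the quantity that the energy subtracts.

Working with \<open>S\<^sub>m\<close> means that only \<open>U\<close> and this last integral have to be differentiable in time,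
which follows from the bound on \<open>u\<^sub>t\<close>; neither the spatial derivatives of \<open>u\<close> nor \<open>|D|\<^sup>s u\<close> are ever
differentiated in time. The three spatial derivatives give \<open>|U(t, \<xi>)| \<le> C (1 + |\<xi>|)\<^sup>-\<^sup>3\<close> locally
uniformly in time, which makes every symbol of order below \<open>2\<close> integrable against \<open>U\<close> and so covers
\<open>2 s < 2\<close>. The function \<open>|D|\<^sup>s u\<close> is
handled as the inverse transform of an integrable, bounded, continuous function, for which
Plancherel's identity is proved by Gaussian regularisation (\<open>inverse_fourier_plancherel\<close>).
\<close>

section \<open>Calculus on the line\<close>

text \<open>The majorant in the decay hypothesis. It serves on the frequency side as well: three integrable
derivatives bound the transform by a multiple of \<open>weight 2\<close>, and a symbol of order \<open>\<alpha>\<close> turns that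
into \<open>weight (2 - \<alpha>)\<close>, which is integrable exactly as long as \<open>\<alpha> < 2\<close>.\<close>

definition weight :: "real \<Rightarrow> real \<Rightarrow> real" where
  "weight \<delta> x = (1 + \<bar>x\<bar>) powr (- (1 + \<delta>))"

lemma weight_nonneg [simp]: "0 \<le> weight \<delta> x"
  by (simp add: weight_def)

lemma weight_measurable [measurable]: "weight \<delta> \<in> borel_measurable borel"
  unfolding weight_def by measurable

lemma weight_le_1: "0 < \<delta> \<Longrightarrow> weight \<delta> x \<le> 1"
  unfolding weight_def by (subst powr_minus) (auto intro!: inverse_le_1_iff[THEN iffD2] disjI2 ge_one_powr_ge_zero)

lemma integrable_weight:
  assumes "0 < \<delta>"
  shows "integrable lborel (weight \<delta>)"
proof -
  let ?h = "\<lambda>x. indicator {0..} x * (1 + x) powr (- (1 + \<delta>)) :: real"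
  let ?F = "\<lambda>x. - (1 / \<delta>) * (1 + x) powr (- \<delta>)"
  have "(\<integral>\<^sup>+x. ennreal ((1 + x) powr (- (1 + \<delta>))) * indicator {0..} x \<partial>lborel)
      = ennreal (0 - ?F 0)"
  proof (rule nn_integral_FTC_atLeast)
    show "DERIV ?F x :> (1 + x) powr (- (1 + \<delta>))" if "0 \<le> x" for x
    proof -
      have "DERIV (\<lambda>x. (1 + x) powr (- \<delta>)) x :> - \<delta> * (1 + x) powr (- \<delta> - of_nat 1) * 1"
        by (rule DERIV_fun_powr) (use that in \<open>auto intro!: derivative_eq_intros\<close>)
      from DERIV_cmult[OF this, of "- (1 / \<delta>)"] show ?thesis
        by (rule DERIV_cong) (use assms in \<open>simp add: algebra_simps minus_diff_commute\<close>)
    qed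
    have "filterlim (\<lambda>x::real. 1 + x) at_top at_top"
      by (rule filterlim_tendsto_add_at_top[OF tendsto_const filterlim_ident])
    from tendsto_neg_powr[OF _ this, of "- \<delta>"] assms
    have "((\<lambda>x. (1 + x) powr (- \<delta>)) \<longlongrightarrow> 0) at_top" by simp
    from tendsto_mult_right_zero[OF this] show "(?F \<longlongrightarrow> 0) at_top" .
  qed auto
  also have "(\<lambda>x. ennreal ((1 + x) powr (- (1 + \<delta>))) * indicator {0..} x) = (\<lambda>x. ennreal (?h x))"
    by (auto simp: indicator_def)
  finally have "(\<integral>\<^sup>+x. ennreal (?h x) \<partial>lborel) < \<infinity>"
    by (simp only: ennreal_less_top infinity_ennreal_def)
  from integrableI_nonneg[OF _ _ this] have "integrable lborel ?h"
    by simp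
  then have "integrable lborel (\<lambda>x. ?h x + ?h (- x))"
    using lborel_integrable_real_affine[of ?h "-1" 0] by auto
  then show ?thesis
    by (rule Bochner_Integration.integrable_bound)
       (auto simp: weight_def indicator_def)
qed

lemma integrable_weight_bound:
  fixes f :: "real \<Rightarrow> 'a :: {banach, second_countable_topology}"
  assumes "0 < \<delta>" and [measurable]: "f \<in> borel_measurable borel"
    and "\<And>x. norm (f x) \<le> C * weight \<delta> x"
  shows "integrable lborel f"
  by (rule Bochner_Integration.integrable_bound[OF integrable_mult_right[OF integrable_weight[OF assms(1)], of C]])
     (use assms(3) in \<open>auto intro: order_trans[OF _ abs_ge_self]\<close>)

lemma tendsto_weight:
  assumes "0 < \<delta>"
  shows "(weight \<delta> \<longlongrightarrow> 0) at_top" "(weight \<delta> \<longlongrightarrow> 0) at_bot"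
proof -
  have 1: "filterlim (\<lambda>x::real. 1 + \<bar>x\<bar>) at_top at_top"
    by (rule filterlim_tendsto_add_at_top[OF tendsto_const filterlim_abs_real])
  from tendsto_neg_powr[OF _ 1, of "- (1 + \<delta>)"] assms
  show l: "(weight \<delta> \<longlongrightarrow> 0) at_top" unfolding weight_def[abs_def] by simp
  show "(weight \<delta> \<longlongrightarrow> 0) at_bot"
    using l unfolding filterlim_at_bot_mirror weight_def[abs_def] by simp
qed

lemma weight_antimono: "\<delta>' \<le> \<delta> \<Longrightarrow> weight \<delta> x \<le> weight \<delta>' x"
  unfolding weight_def by (rule powr_mono) auto

lemma weight_mult_powr: "(1 + \<bar>x\<bar>) powr \<alpha> * weight \<delta> x = weight (\<delta> - \<alpha>) x"
  by (simp add: weight_def powr_add[symmetric] algebra_simps)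

text \<open>The boundary terms of every integration by parts below vanish by this lemma: it yields the
transform of a derivative and disposes of the total derivative in the momentum balance.\<close>

lemma integral_derivative_eq_0:
  fixes F f :: "real \<Rightarrow> 'a :: euclidean_space"
  assumes "\<And>x. (F has_vector_derivative f x) (at x)" and "\<And>x. isCont f x"
    and "integrable lborel f" and "(F \<longlongrightarrow> 0) at_top" and "(F \<longlongrightarrow> 0) at_bot"
  shows "(LINT x|lborel. f x) = 0"
proof -
  have "(LBINT x=-\<infinity>..\<infinity>. f x) = 0 - 0"
    by (rule interval_integral_FTC_integrable[where F = F])
       (use assms in \<open>auto simp: ereal_tendsto_simps set_integrable_def\<close>)
  then show ?thesis
    by (simp add: interval_lebesgue_integral_def set_lebesgue_integral_def)
qed

lemma has_vector_derivative_iff_quotient: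
  fixes f :: "real \<Rightarrow> 'a :: real_normed_vector"
  shows "(f has_vector_derivative D) (at t) \<longleftrightarrow> ((\<lambda>\<tau>. (f \<tau> - f t) /\<^sub>R (\<tau> - t)) \<longlongrightarrow> D) (at t)"
proof -
  have "(f has_vector_derivative D) (at t) \<longleftrightarrow>
      ((\<lambda>\<tau>. norm (f \<tau> - f t - (\<tau> - t) *\<^sub>R D) / norm (\<tau> - t)) \<longlongrightarrow> 0) (at t)"
    unfolding has_vector_derivative_def has_derivative_iff_norm
    by (auto simp: bounded_linear_scaleR_left)
  also have "\<dots> \<longleftrightarrow> ((\<lambda>\<tau>. norm ((f \<tau> - f t) /\<^sub>R (\<tau> - t) - D)) \<longlongrightarrow> 0) (at t)"
  proof (rule filterlim_cong[OF refl refl])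
    have "norm (f \<tau> - f t - (\<tau> - t) *\<^sub>R D) / norm (\<tau> - t) = norm ((f \<tau> - f t) /\<^sub>R (\<tau> - t) - D)"
      if "\<tau> \<noteq> t" for \<tau>
    proof -
      have "f \<tau> - f t - (\<tau> - t) *\<^sub>R D = (\<tau> - t) *\<^sub>R ((f \<tau> - f t) /\<^sub>R (\<tau> - t) - D)"
        using that by (simp add: scaleR_diff_right)
      then show ?thesis using that by simp
    qed
    then show "\<forall>\<^sub>F \<tau> in at t. norm (f \<tau> - f t - (\<tau> - t) *\<^sub>R D) / norm (\<tau> - t)
        = norm ((f \<tau> - f t) /\<^sub>R (\<tau> - t) - D)"
      by (auto simp: eventually_at_filter)
  qed
  finally show ?thesis
    by (simp add: tendsto_norm_zero_iff LIM_zero_iff)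
qed

text \<open>By the mean value inequality the difference quotients in the parameter are bounded by \<open>w\<close>, so
dominated convergence applies along every sequence of parameters tending to \<open>t\<close>. Measurability
of \<open>F' t\<close> is a consequence, as a pointwise limit of difference quotients; this is how integrability
of the time derivative of a solution is obtained later.\<close>

lemma has_vector_derivative_integral:
  fixes F F' :: "real \<Rightarrow> 'a \<Rightarrow> 'b :: {banach, second_countable_topology}"
  assumes t: "t \<in> {a<..<b}"
    and deriv: "\<And>\<tau> x. \<tau> \<in> {a<..<b} \<Longrightarrow> ((\<lambda>r. F r x) has_vector_derivative F' \<tau> x) (at \<tau>)"
    and int: "\<And>\<tau>. \<tau> \<in> {a<..<b} \<Longrightarrow> integrable M (F \<tau>)"
    and bound: "\<And>\<tau> x. \<tau> \<in> {a<..<b} \<Longrightarrow> norm (F' \<tau> x) \<le> w x"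
    and w: "integrable M w"
  shows "integrable M (F' t)"
    and "((\<lambda>\<tau>. LINT x|M. F \<tau> x) has_vector_derivative (LINT x|M. F' t x)) (at t)"
proof -
  let ?q = "\<lambda>\<tau> x. (F \<tau> x - F t x) /\<^sub>R (\<tau> - t)"
  have lip: "norm (?q \<tau> x) \<le> w x" if \<tau>: "\<tau> \<in> {a<..<b}" for \<tau> x
  proof (cases "\<tau> = t")
    case True
    then show ?thesis using bound[OF t, of x] by (auto intro: order_trans[OF norm_ge_zero])
  next
    case False
    have "norm (F \<tau> x - F t x) \<le> w x * norm (\<tau> - t)"
    proof (rule differentiable_bound[of "{a<..<b}" "\<lambda>r. F r x" "\<lambda>r h. h *\<^sub>R F' r x"])
      fix r assume r: "r \<in> {a<..<b}"
      show "((\<lambda>r. F r x) has_derivative (\<lambda>h. h *\<^sub>R F' r x)) (at r within {a<..<b})"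
        using deriv[OF r] has_derivative_at_withinI unfolding has_vector_derivative_def by blast
      show "onorm (\<lambda>h. h *\<^sub>R F' r x) \<le> w x"
        by (rule onorm_le) (use bound[OF r, of x] in \<open>auto simp: mult.commute intro: mult_left_mono\<close>)
    qed (use t \<tau> in auto)
    then show ?thesis using False by (simp add: divide_simps)
  qed
  have [measurable]: "F \<tau> \<in> borel_measurable M" if "\<tau> \<in> {a<..<b}" for \<tau>
    using int[OF that] by auto
  have seq: "integrable M (F' t) \<and> (\<lambda>n. LINT x|M. ?q (\<tau> n) x) \<longlonglongrightarrow> (LINT x|M. F' t x)"
    if \<tau>: "\<And>n. \<tau> n \<in> {a<..<b} - {t}" "\<tau> \<longlonglongrightarrow> t" for \<tau> :: "nat \<Rightarrow> real"
  proof -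
    have lim: "(\<lambda>n. ?q (\<tau> n) x) \<longlonglongrightarrow> F' t x" for x
      using deriv[OF t, of x] \<tau> unfolding has_vector_derivative_iff_quotient tendsto_at_iff_sequentially
      by (auto simp: comp_def)
    have [measurable]: "?q (\<tau> n) \<in> borel_measurable M" for n
    proof -
      have "F (\<tau> n) \<in> borel_measurable M" "F t \<in> borel_measurable M"
        using int[OF t] int[of "\<tau> n"] \<tau>(1)[of n] by auto
      then show ?thesis by measurable
    qed
    have [measurable]: "F' t \<in> borel_measurable M"
      by (rule borel_measurable_LIMSEQ_metric[OF _ lim]) auto
    have b: "AE x in M. norm (?q (\<tau> n) x) \<le> w x" for n
      using lip \<tau>(1)[of n] by auto
    show ?thesis
      using integrable_dominated_convergence[OF _ _ w _ b, of "F' t" "\<lambda>n. n"]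
        integral_dominated_convergence[OF _ _ w _ b, of "F' t" "\<lambda>n. n"] lim by auto
  qed
  \<comment> \<open>A concrete sequence in the interval is needed for integrability of the limit.\<close>
  let ?\<tau> = "\<lambda>n. t + (b - t) / real (Suc (Suc n))"
  have "?\<tau> \<longlonglongrightarrow> t + 0"
    by (intro tendsto_intros LIMSEQ_Suc lim_const_over_n)
  then have \<tau>_lim: "?\<tau> \<longlonglongrightarrow> t" by (simp only: add_0_right)
  have \<tau>_in: "?\<tau> n \<in> {a<..<b} - {t}" for n
  proof -
    have "0 < (b - t) / real (Suc (Suc n))" "(b - t) / real (Suc (Suc n)) < b - t"
      using t by (auto simp: divide_simps)
    then show ?thesis using t unfolding Diff_iff greaterThanLessThan_iff singleton_iff by linarith
  qed
  show "integrable M (F' t)" by (rule seq[OF \<tau>_in \<tau>_lim, THEN conjunct1])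
  have "((\<lambda>\<tau>. LINT x|M. ?q \<tau> x) \<longlongrightarrow> (LINT x|M. F' t x)) (at t within {a<..<b})"
    unfolding tendsto_at_iff_sequentially using seq by (auto simp: comp_def)
  then have "((\<lambda>\<tau>. LINT x|M. ?q \<tau> x) \<longlongrightarrow> (LINT x|M. F' t x)) (at t)"
    by (simp only: at_within_open[OF t open_greaterThanLessThan])
  moreover have "\<forall>\<^sub>F \<tau> in at t. (LINT x|M. ?q \<tau> x) = ((LINT x|M. F \<tau> x) - (LINT x|M. F t x)) /\<^sub>R (\<tau> - t)"
    using eventually_at_in_open'[of "{a<..<b}" t]
    by (rule eventually_mono) (use t int in auto)
  ultimately show "((\<lambda>\<tau>. LINT x|M. F \<tau> x) has_vector_derivative (LINT x|M. F' t x)) (at t)"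
    unfolding has_vector_derivative_iff_quotient by (rule Lim_transform_eventually)
qed

text \<open>The chain rule for \<open>y powr p\<close> remains true at zeros of \<open>q\<close>: there the difference quotient of
\<open>q powr p\<close> is \<open>q powr (p - 1)\<close>, which tends to \<open>0\<close>, times the difference quotient of \<open>q\<close>. A solution
may vanish, so the potential energy density has to be differentiated at such points.\<close>

lemma DERIV_powr_nonneg:
  fixes q :: "real \<Rightarrow> real"
  assumes q: "(q has_real_derivative d) (at t)" and nn: "\<And>\<tau>. 0 \<le> q \<tau>" and p: "1 < p"
  shows "((\<lambda>\<tau>. q \<tau> powr p) has_real_derivative p * q t powr (p - 1) * d) (at t)"
proof (cases "q t = 0")
  case False
  then show ?thesis using DERIV_fun_powr[OF q, of p] nn[of t] by simp
next
  case True
  have "(q \<longlongrightarrow> 0) (at t)" using DERIV_isCont[OF q] True by (simp add: isCont_def)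
  then have "((\<lambda>y. q y powr (p - 1)) \<longlongrightarrow> 0) (at t)"
    using tendsto_powr'[of q 0 "at t" "\<lambda>_. p - 1" "p - 1"] p nn by auto
  moreover have "((\<lambda>y. (q y - q t) / (y - t)) \<longlongrightarrow> d) (at t)"
    using q by (simp add: has_field_derivative_iff)
  ultimately have "((\<lambda>y. q y powr (p - 1) * ((q y - q t) / (y - t))) \<longlongrightarrow> 0 * d) (at t)"
    by (rule tendsto_mult)
  moreover have "(\<lambda>y. q y powr (p - 1) * ((q y - q t) / (y - t))) = (\<lambda>y. (q y powr p - q t powr p) / (y - t))"
  proof
    fix y
    have "q y powr (p - 1) * q y = q y powr p"
      using nn[of y] by (cases "q y = 0") (auto simp: powr_diff)
    then show "q y powr (p - 1) * ((q y - q t) / (y - t)) = (q y powr p - q t powr p) / (y - t)"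
      using True p by simp
  qed
  ultimately show ?thesis
    using True p by (simp add: has_field_derivative_iff)
qed

lemma has_real_derivative_norm_square:
  fixes z :: "real \<Rightarrow> complex"
  assumes "(z has_vector_derivative z') (at t)"
  shows "((\<lambda>\<tau>. (norm (z \<tau>))\<^sup>2) has_real_derivative 2 * Re (z' * cnj (z t))) (at t)"
proof -
  have "((\<lambda>\<tau>. Re (z \<tau>)) has_real_derivative Re z') (at t)" "((\<lambda>\<tau>. Im (z \<tau>)) has_real_derivative Im z') (at t)"
    using assms by (simp_all only: has_vector_derivative_complex_iff)
  from DERIV_add[OF this[THEN DERIV_power, of 2]] show ?thesis
    unfolding cmod_power2 by (rule DERIV_cong) simp
qed

lemma eq_of_stationary:
  fixes f :: "real \<Rightarrow> real"
  assumes "\<And>t. 0 < t \<Longrightarrow> (f has_real_derivative 0) (at t)" and "0 < t1" "0 < t2"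
  shows "f t1 = f t2"
proof -
  have "\<exists>c. \<forall>t\<in>{0<..}. f t = c"
    by (rule has_field_derivative_zero_constant)
       (use assms(1) in \<open>auto intro: has_field_derivative_at_within\<close>)
  then show ?thesis using assms by auto
qed

lemma norm_square_powr: "(cmod z)\<^sup>2 powr \<sigma> = cmod z powr (2 * \<sigma>)"
  by (cases "z = 0") (simp_all add: powr_powr flip: powr_numeral)

section \<open>The Fourier transform\<close>

lemma cnj_measurable [measurable]: "cnj \<in> borel_measurable borel"
  by (intro borel_measurable_continuous_onI continuous_intros)

definition inverse_fourier :: "(real \<Rightarrow> complex) \<Rightarrow> real \<Rightarrow> complex" where
  "inverse_fourier \<phi> x = 1 / (2 * pi) * (LINT \<eta>|lborel. \<phi> \<eta> * iexp (\<eta> * x))"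

lemma fourier_multiplier_eq:
  "fourier_multiplier m f = inverse_fourier (\<lambda>\<xi>. m \<xi> * fourier f \<xi>)"
  by (simp add: fun_eq_iff fourier_multiplier_def inverse_fourier_def)

lemma integrable_times_iexp:
  fixes f :: "real \<Rightarrow> complex"
  assumes "integrable lborel f" and [measurable]: "\<theta> \<in> borel_measurable borel"
  shows "integrable lborel (\<lambda>x. f x * iexp (\<theta> x))"
proof -
  have [measurable]: "f \<in> borel_measurable borel" using assms by auto
  show ?thesis
    by (rule Bochner_Integration.integrable_bound[OF assms(1)]) (auto simp: norm_mult)
qed

lemma fourier_measurable [measurable]:
  assumes [measurable]: "f \<in> borel_measurable borel"
  shows "fourier f \<in> borel_measurable borel"
proof -
  have "(\<lambda>\<xi>. LINT x|lborel. f x * iexp (- (\<xi> * x))) \<in> borel_measurable borel"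
    by (rule sigma_finite_measure.borel_measurable_lebesgue_integral[OF lborel.sigma_finite_measure_axioms]) measurable
  then show ?thesis by (simp add: fourier_def[abs_def])
qed

lemma inverse_fourier_measurable [measurable]:
  assumes [measurable]: "f \<in> borel_measurable borel"
  shows "inverse_fourier f \<in> borel_measurable borel"
proof -
  have "(\<lambda>\<xi>. LINT x|lborel. f x * iexp (x * \<xi>)) \<in> borel_measurable borel"
    by (rule sigma_finite_measure.borel_measurable_lebesgue_integral[OF lborel.sigma_finite_measure_axioms]) measurable
  then show ?thesis by (simp add: inverse_fourier_def[abs_def])
qed

lemma norm_fourier_le: "norm (fourier f \<xi>) \<le> (LINT x|lborel. norm (f x))"
  unfolding fourier_def by (rule order_trans[OF integral_norm_bound]) (simp add: norm_mult)

lemma norm_inverse_fourier_le: "norm (inverse_fourier \<phi> x) \<le> (LINT \<eta>|lborel. norm (\<phi> \<eta>)) / (2 * pi)"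
proof -
  have "norm (LINT \<eta>|lborel. \<phi> \<eta> * iexp (\<eta> * x)) \<le> (LINT \<eta>|lborel. norm (\<phi> \<eta>))"
    by (rule order_trans[OF integral_norm_bound]) (simp add: norm_mult)
  then show ?thesis
    unfolding inverse_fourier_def by (simp add: norm_mult norm_divide divide_right_mono)
qed

lemma isCont_fourier:
  assumes "integrable lborel f"
  shows "isCont (fourier f) \<xi>"
  unfolding continuous_at_sequentially
proof (intro allI impI)
  have [measurable]: "f \<in> borel_measurable borel" using assms by auto
  fix z :: "nat \<Rightarrow> real" assume z: "z \<longlonglongrightarrow> \<xi>"
  show "(fourier f \<circ> z) \<longlonglongrightarrow> fourier f \<xi>"
    unfolding comp_def fourier_def
    by (rule integral_dominated_convergence[where w = "\<lambda>x. norm (f x)"])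
       (use assms in \<open>auto simp: norm_mult intro!: tendsto_intros z\<close>)
qed

lemma fourier_add:
  assumes "integrable lborel f" "integrable lborel g"
  shows "fourier (\<lambda>x. f x + g x) \<xi> = fourier f \<xi> + fourier g \<xi>"
proof -
  have "integrable lborel (\<lambda>x. f x * iexp (- (\<xi> * x)))" "integrable lborel (\<lambda>x. g x * iexp (- (\<xi> * x)))"
    using integrable_times_iexp[OF assms(1), of "\<lambda>x. - (\<xi> * x)"]
      integrable_times_iexp[OF assms(2), of "\<lambda>x. - (\<xi> * x)"] by simp_all
  from Bochner_Integration.integral_add[OF this] show ?thesis
    unfolding fourier_def by (simp add: algebra_simps)
qed

lemma fourier_cmult: "fourier (\<lambda>x. c * f x) \<xi> = c * fourier f \<xi>"
  unfolding fourier_def by (simp add: mult.assoc)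

lemma fourier_cnj: "fourier (\<lambda>x. cnj (f x)) \<xi> = cnj (fourier f (- \<xi>))"
  unfolding fourier_def
  by (simp add: Bochner_Integration.integral_cnj[symmetric] del: Bochner_Integration.integral_cnj add: exp_cnj)

lemma fourier_derivative:
  assumes f: "\<And>x. (f has_vector_derivative f' x) (at x)" and cont: "\<And>x. isCont f' x"
    and int: "integrable lborel f" "integrable lborel f'"
    and lim: "(f \<longlongrightarrow> 0) at_top" "(f \<longlongrightarrow> 0) at_bot"
  shows "fourier f' \<xi> = \<i> * \<xi> * fourier f \<xi>"
proof -
  let ?e = "\<lambda>x. iexp (- (\<xi> * x))"
  have contf: "isCont f x" for x
    using f[of x] has_vector_derivative_continuous by blast
  have e: "(?e has_vector_derivative - (\<i> * \<xi>) * ?e x) (at x)" for x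
  proof -
    have "((\<lambda>z. exp (\<i> * - (\<xi> * z))) has_field_derivative - (\<i> * \<xi>) * ?e x) (at (of_real x))"
      by (auto intro!: derivative_eq_intros)
    from has_vector_derivative_real_field[OF this] show ?thesis by simp
  qed
  have i1: "integrable lborel (\<lambda>x. f' x * ?e x)" and i2: "integrable lborel (\<lambda>x. f x * ?e x)"
    using integrable_times_iexp[OF int(1), of "\<lambda>x. - (\<xi> * x)"]
      integrable_times_iexp[OF int(2), of "\<lambda>x. - (\<xi> * x)"] by simp_all
  have l: "((\<lambda>x. f x * ?e x) \<longlongrightarrow> 0) F" if "(f \<longlongrightarrow> 0) F" for F
    using that tendsto_norm_zero_iff[of "\<lambda>x. f x * ?e x" F] tendsto_norm_zero_iff[of f F]
    by (simp add: norm_mult)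
  have "(LINT x|lborel. f' x * ?e x - \<i> * \<xi> * (f x * ?e x)) = 0"
  proof (rule integral_derivative_eq_0[where F = "\<lambda>x. f x * ?e x"])
    show "((\<lambda>x. f x * ?e x) has_vector_derivative f' x * ?e x - \<i> * \<xi> * (f x * ?e x)) (at x)" for x
      using has_vector_derivative_mult[OF f[of x] e[of x]] by (simp add: algebra_simps)
    show "isCont (\<lambda>x. f' x * ?e x - \<i> * \<xi> * (f x * ?e x)) x" for x
      using cont contf by (intro continuous_intros) auto
  qed (use i1 i2 l lim in auto)
  then show ?thesis using i1 i2 by (simp add: fourier_def)
qed

text \<open>Plain Fubini: integrability of \<open>\<phi>\<close> in frequency and of \<open>g\<close> in space makes the double integral
absolutely convergent.\<close>

lemma parseval_inverse_fourier:
  assumes phi: "integrable lborel \<phi>" and g: "integrable lborel g"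
  shows "(LINT x|lborel. inverse_fourier \<phi> x * cnj (g x))
       = 1 / (2 * pi) * (LINT \<eta>|lborel. \<phi> \<eta> * cnj (fourier g \<eta>))"
proof -
  have [measurable]: "\<phi> \<in> borel_measurable borel" "g \<in> borel_measurable borel"
    using phi g by auto
  let ?k = "\<lambda>x \<eta>. \<phi> \<eta> * iexp (\<eta> * x) * cnj (g x)"
  have k: "integrable lborel (\<lambda>\<eta>. ?k x \<eta>)" for x
    using integrable_times_iexp[OF phi, of "\<lambda>\<eta>. \<eta> * x"] by simp
  have "integrable (lborel \<Otimes>\<^sub>M lborel) (\<lambda>(x, \<eta>). ?k x \<eta>)"
  proof (rule lborel_pair.Fubini_integrable)
    show "(\<lambda>(x, \<eta>). ?k x \<eta>) \<in> borel_measurable (lborel \<Otimes>\<^sub>M lborel)" by measurable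
    show "integrable lborel (\<lambda>x. LINT y|lborel. norm (case (x, y) of (x, \<eta>) \<Rightarrow> ?k x \<eta>))"
      using g by (simp add: norm_mult)
  qed (use k in simp)
  then have fub: "(LINT \<eta>|lborel. (LINT x|lborel. ?k x \<eta>)) = (LINT x|lborel. (LINT \<eta>|lborel. ?k x \<eta>))"
    by (rule lborel_pair.Fubini_integral)
  have "(LINT x|lborel. ?k x \<eta>) = \<phi> \<eta> * cnj (fourier g \<eta>)" for \<eta>
    unfolding fourier_def
    by (simp add: Bochner_Integration.integral_cnj[symmetric] del: Bochner_Integration.integral_cnj
        add: exp_cnj mult.assoc mult.commute[of "cnj _"])
  moreover have "(LINT \<eta>|lborel. ?k x \<eta>) = (2 * pi) * (inverse_fourier \<phi> x * cnj (g x))" for x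
    by (simp add: inverse_fourier_def)
  ultimately have "(LINT \<eta>|lborel. \<phi> \<eta> * cnj (fourier g \<eta>))
      = (LINT x|lborel. (2 * pi) * (inverse_fourier \<phi> x * cnj (g x)))"
    using fub by (simp only:)
  also have "\<dots> = (2 * pi) * (LINT x|lborel. inverse_fourier \<phi> x * cnj (g x))"
    by (rule integral_mult_right_zero)
  finally show ?thesis by simp
qed

text \<open>Inversion in the order opposite to \<open>fourier_inversion\<close>. That theorem applies with the roles of
space and frequency exchanged, since up to a reflection and the factor \<open>1 / (2 * pi)\<close> the transform
of \<open>f\<close> is its inverse transform.\<close>

lemma inverse_fourier_fourier:
  assumes f: "integrable lborel f" and bdd: "\<And>x. norm (f x) \<le> B" and cont: "isCont f x"
    and int: "integrable lborel (fourier f)"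
  shows "inverse_fourier (fourier f) x = f x"
proof -
  define g where "g \<xi> = 1 / (2 * pi) * fourier f (- \<xi>)" for \<xi>
  have "integrable lborel (\<lambda>\<xi>. fourier f (0 + (- 1) * \<xi>))"
    using int by (rule lborel_integrable_real_affine) simp
  then have "integrable lborel g"
    unfolding g_def[abs_def] by (intro integrable_mult_right) simp
  then have "fourier g x = f x"
    by (intro fourier_inversion[OF f bdd cont])
       (auto simp: g_def fourier_def mult.commute)
  moreover have "fourier g x = (LINT \<xi>|lborel. g (- \<xi>) * iexp (- (x * - \<xi>)))"
    unfolding fourier_def by (rule lborel_integral_minus[symmetric])
  ultimately show ?thesis
    by (simp add: g_def inverse_fourier_def mult.commute)
qed

text \<open>The inverse transform \<open>g\<close> of \<open>\<phi>\<close> is bounded but not known to be integrable, so Fubini does not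
give Plancherel's identity directly. Damping by the Gaussian of width \<open>r n\<close> produces integrable
functions \<open>h n\<close> whose transforms are Gaussian averages of \<open>\<phi>\<close>, hence converge boundedly to
\<open>\<phi>\<close> up to the constant \<open>c\<close> (the Gaussian's value at \<open>0\<close>). Parseval's identity for \<open>g\<close> and \<open>h n\<close>
then passes to the limit, by dominated convergence in frequency and monotone convergence in space.
The lemma is what makes \<open>|D|\<^sup>s u\<close> square integrable.\<close>

lemma inverse_fourier_plancherel:
  assumes phi: "integrable lborel \<phi>" and bdd: "\<And>\<eta>. norm (\<phi> \<eta>) \<le> B" and cont: "\<And>\<eta>. isCont \<phi> \<eta>"
  shows "integrable lborel (\<lambda>x. (norm (inverse_fourier \<phi> x))\<^sup>2)"
    and "(LINT x|lborel. (norm (inverse_fourier \<phi> x))\<^sup>2) = 1 / (2 * pi) * (LINT \<eta>|lborel. (norm (\<phi> \<eta>))\<^sup>2)"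
proof -
  define g where "g = inverse_fourier \<phi>"
  define r where "r n = real (Suc n)" for n
  define c where "c = 1 / sqrt (2 * pi)"
  define h where "h n x = g x * std_normal_density (x / r n)" for n x
  have r: "r n > 0" for n by (simp add: r_def)
  have rlim: "(\<lambda>n. x / r n) \<longlonglongrightarrow> 0" for x
    unfolding r_def by (rule LIMSEQ_Suc) (rule lim_const_over_n)
  have c: "c > 0" by (simp add: c_def)
  have c2: "c * c * (2 * pi) = 1" by (simp add: c_def field_simps)
  have B: "0 \<le> B" using bdd[of 0] norm_ge_zero order_trans by blast
  have [measurable]: "\<phi> \<in> borel_measurable borel" using phi by auto
  have [measurable]: "g \<in> borel_measurable borel" unfolding g_def by measurable
  define G where "G = (LINT \<eta>|lborel. norm (\<phi> \<eta>)) / (2 * pi)"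
  have G: "norm (g x) \<le> G" for x unfolding g_def G_def by (rule norm_inverse_fourier_le)
  have rho: "integrable lborel (\<lambda>x. std_normal_density (x / r n))" for n
    using lborel_integrable_real_affine[of "std_normal_density" "1 / r n" 0] r[of n] by simp
  have h: "integrable lborel (h n)" for n
    unfolding h_def[abs_def]
    by (rule Bochner_Integration.integrable_bound[OF integrable_mult_right[OF rho[of n], of G]])
       (auto simp: norm_mult abs_mult normal_density_nonneg intro!: mult_right_mono order_trans[OF G abs_ge_self])
  have fourier_h: "fourier (h n) \<xi> = c * (LINT z|lborel. \<phi> (\<xi> + z / r n) * std_normal_density z)" for n \<xi>
  proof -
    \<comment> \<open>The value of the transform at \<open>\<xi>\<close> is an inner product of \<open>g\<close> with the modulated Gaussian \<open>k\<close>, so Parseval moves it to the frequency side, where the transform of \<open>k\<close> is explicit.\<close>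
    define k where "k x = iexp (\<xi> * x) * complex_of_real (std_normal_density (x / r n))" for x
    have k: "integrable lborel k"
      using integrable_times_iexp[OF rho[of n, THEN integrable_of_real], of "\<lambda>x. \<xi> * x"]
      by (simp add: k_def[abs_def] mult.commute)
    have fk: "fourier k \<eta> = complex_of_real (r n * exp (- (((\<xi> - \<eta>) * r n)\<^sup>2) / 2))" for \<eta>
    proof -
      have "fourier k \<eta> = (LINT x|lborel. iexp ((\<xi> - \<eta>) * x) * complex_of_real (std_normal_density (x / r n)))"
        unfolding fourier_def k_def
        by (rule Bochner_Integration.integral_cong) (auto simp: algebra_simps exp_add[symmetric] exp_diff exp_minus field_simps)
      also note gaussian_fourier[OF r]
      finally show ?thesis .
    qed
    have "fourier (h n) \<xi> = (LINT x|lborel. g x * cnj (k x))"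
      unfolding fourier_def h_def k_def
      by (rule Bochner_Integration.integral_cong) (auto simp: exp_cnj)
    also have "\<dots> = 1 / (2 * pi) * (LINT \<eta>|lborel. \<phi> \<eta> * complex_of_real (r n * exp (- (((\<xi> - \<eta>) * r n)\<^sup>2) / 2)))"
      unfolding g_def by (simp only: parseval_inverse_fourier[OF phi k] fk complex_cnj_complex_of_real)
    also have "(LINT \<eta>|lborel. \<phi> \<eta> * complex_of_real (r n * exp (- (((\<xi> - \<eta>) * r n)\<^sup>2) / 2)))
       = (1 / r n) *\<^sub>R (LINT z|lborel. \<phi> (\<xi> + z / r n) * complex_of_real (r n * exp (- z\<^sup>2 / 2)))"
      using lborel_integral_real_affine[of "1 / r n" "\<lambda>\<eta>. \<phi> \<eta> * complex_of_real (r n * exp (- (((\<xi> - \<eta>) * r n)\<^sup>2) / 2))" \<xi>] r[of n]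
      by simp
    also have "(LINT z|lborel. \<phi> (\<xi> + z / r n) * complex_of_real (r n * exp (- z\<^sup>2 / 2)))
       = (LINT z|lborel. complex_of_real (r n / c) * (\<phi> (\<xi> + z / r n) * complex_of_real (std_normal_density z)))"
      using c by (intro Bochner_Integration.integral_cong refl) (simp add: std_normal_density_def c_def)
    also have "\<dots> = complex_of_real (r n / c) * (LINT z|lborel. \<phi> (\<xi> + z / r n) * complex_of_real (std_normal_density z))"
      by (rule integral_mult_right_zero)
    also have "complex_of_real (1 / (2 * pi)) * ((1 / r n) *\<^sub>R (complex_of_real (r n / c) * X)) = complex_of_real c * X" for X
    proof -
      have "1 / (2 * pi) * (1 / r n * (r n / c)) = c"
        using c r[of n] c2 by (simp add: divide_simps mult_ac)
      then have "complex_of_real (1 / (2 * pi) * (1 / r n * (r n / c))) * X = complex_of_real c * X" by simp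
      then show ?thesis by (simp only: scaleR_conv_of_real of_real_mult of_real_divide mult.assoc)
    qed
    finally show ?thesis .
  qed
  have bound_h: "norm (fourier (h n) \<xi>) \<le> c * B" for n \<xi>
  proof -
    have B_rho: "integrable lborel (\<lambda>z. B * std_normal_density z)" by simp
    have "norm (LINT z|lborel. \<phi> (\<xi> + z / r n) * std_normal_density z) \<le> (LINT z|lborel. B * std_normal_density z)"
    proof (rule Bochner_Integration.integral_norm_bound_integral[OF _ B_rho])
      have le: "norm (\<phi> (\<xi> + z / r n) * std_normal_density z) \<le> B * std_normal_density z" for z
        using bdd by (auto simp: norm_mult normal_density_nonneg mult_right_mono)
      then show "integrable lborel (\<lambda>z. \<phi> (\<xi> + z / r n) * std_normal_density z)"
        by (intro Bochner_Integration.integrable_bound[OF B_rho] AE_I2 order_trans[OF le]) auto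
    qed (use bdd in \<open>auto simp: norm_mult normal_density_nonneg mult_right_mono\<close>)
    then show ?thesis using c by (simp add: fourier_h norm_mult)
  qed
  have lim_h: "(\<lambda>n. fourier (h n) \<xi>) \<longlonglongrightarrow> c * \<phi> \<xi>" for \<xi>
  proof -
    have "(\<lambda>n. LINT z|lborel. \<phi> (\<xi> + z / r n) * complex_of_real (std_normal_density z))
       \<longlonglongrightarrow> (LINT z|lborel. \<phi> \<xi> * complex_of_real (std_normal_density z))"
    proof (rule integral_dominated_convergence[where w = "\<lambda>z. B * std_normal_density z"])
      have "(\<lambda>i. \<phi> (\<xi> + z / r i)) \<longlonglongrightarrow> \<phi> \<xi>" for z
      proof -
        have "(\<lambda>i. \<xi> + z / r i) \<longlonglongrightarrow> \<xi> + 0" by (intro tendsto_intros rlim)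
        then show ?thesis using isCont_tendsto_compose[OF cont] by simp
      qed
      then show "AE z in lborel. (\<lambda>i. \<phi> (\<xi> + z / r i) * complex_of_real (std_normal_density z))
         \<longlonglongrightarrow> \<phi> \<xi> * complex_of_real (std_normal_density z)"
        by (intro AE_I2 tendsto_intros)
    qed (use bdd in \<open>auto simp: norm_mult normal_density_nonneg mult_right_mono\<close>)
    then show ?thesis unfolding fourier_h by (auto intro: tendsto_intros)
  qed
  have "(\<lambda>n. LINT \<eta>|lborel. \<phi> \<eta> * cnj (fourier (h n) \<eta>)) \<longlonglongrightarrow> (LINT \<eta>|lborel. \<phi> \<eta> * cnj (c * \<phi> \<eta>))"
  proof (rule integral_dominated_convergence[where w = "\<lambda>\<eta>. norm (\<phi> \<eta>) * (c * B)"])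
    have [measurable]: "h n \<in> borel_measurable borel" for n using h[of n] by auto
    show "(\<lambda>\<eta>. \<phi> \<eta> * cnj (fourier (h n) \<eta>)) \<in> borel_measurable lborel" for n by measurable
    show "AE \<eta> in lborel. (\<lambda>n. \<phi> \<eta> * cnj (fourier (h n) \<eta>)) \<longlonglongrightarrow> \<phi> \<eta> * cnj (c * \<phi> \<eta>)"
      by (intro AE_I2 tendsto_intros lim_h)
  qed (use phi bound_h in \<open>auto simp: norm_mult intro!: mult_left_mono\<close>)
  then have "(\<lambda>n. 1 / (2 * pi) * (LINT \<eta>|lborel. \<phi> \<eta> * cnj (fourier (h n) \<eta>)))
      \<longlonglongrightarrow> 1 / (2 * pi) * (LINT \<eta>|lborel. \<phi> \<eta> * cnj (c * \<phi> \<eta>))"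
    by (intro tendsto_intros)
  then have "(\<lambda>n. LINT x|lborel. g x * cnj (h n x)) \<longlonglongrightarrow> 1 / (2 * pi) * (LINT \<eta>|lborel. \<phi> \<eta> * cnj (c * \<phi> \<eta>))"
    by (simp only: parseval_inverse_fourier[OF phi h] g_def)
  moreover have "g x * cnj (h n x) = complex_of_real ((norm (g x))\<^sup>2 * std_normal_density (x / r n))" for n x
    by (simp only: h_def complex_cnj_mult complex_cnj_complex_of_real of_real_mult complex_norm_square mult.assoc)
  moreover have "\<phi> \<eta> * cnj (c * \<phi> \<eta>) = complex_of_real (c * (norm (\<phi> \<eta>))\<^sup>2)" for \<eta>
    by (simp only: complex_cnj_mult complex_cnj_complex_of_real of_real_mult complex_norm_square mult_ac)
  ultimately have "(\<lambda>n. complex_of_real (LINT x|lborel. (norm (g x))\<^sup>2 * std_normal_density (x / r n)))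
      \<longlonglongrightarrow> complex_of_real (1 / (2 * pi) * (LINT \<eta>|lborel. c * (norm (\<phi> \<eta>))\<^sup>2))"
    by (simp only: integral_complex_of_real flip: of_real_mult)
  then have lim: "(\<lambda>n. LINT x|lborel. (norm (g x))\<^sup>2 * std_normal_density (x / r n))
      \<longlonglongrightarrow> 1 / (2 * pi) * (LINT \<eta>|lborel. c * (norm (\<phi> \<eta>))\<^sup>2)"
    by (simp only: tendsto_of_real_iff)
  have mc: "integrable lborel (\<lambda>x. (norm (g x))\<^sup>2 * c)"
    "(LINT x|lborel. (norm (g x))\<^sup>2 * c) = 1 / (2 * pi) * (LINT \<eta>|lborel. c * (norm (\<phi> \<eta>))\<^sup>2)"
  proof -
    have i: "integrable lborel (\<lambda>x. (norm (g x))\<^sup>2 * std_normal_density (x / r n))" for n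
      by (rule Bochner_Integration.integrable_bound[OF integrable_mult_right[OF rho[of n], of "G\<^sup>2"]])
         (use G in \<open>auto simp: abs_mult normal_density_nonneg intro!: mult_right_mono power_mono\<close>)
    have m: "AE x in lborel. mono (\<lambda>n. (norm (g x))\<^sup>2 * std_normal_density (x / r n))"
    proof (intro AE_I2 monoI mult_left_mono)
      fix x m n assume "(m::nat) \<le> n"
      then have "\<bar>x / r n\<bar> \<le> \<bar>x / r m\<bar>"
        by (simp add: r_def abs_divide divide_left_mono)
      then show "std_normal_density (x / r m) \<le> std_normal_density (x / r n)"
        unfolding std_normal_density_def by (simp add: divide_right_mono abs_le_square_iff del: abs_divide)
    qed simp
    have l: "AE x in lborel. (\<lambda>n. (norm (g x))\<^sup>2 * std_normal_density (x / r n)) \<longlonglongrightarrow> (norm (g x))\<^sup>2 * c"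
    proof (intro AE_I2 tendsto_intros)
      fix x
      have "(\<lambda>i. std_normal_density (x / r i)) \<longlonglongrightarrow> 1 / sqrt (2 * pi) * exp (- 0\<^sup>2 / 2)"
        unfolding std_normal_density_def by (intro tendsto_intros rlim) auto
      then show "(\<lambda>i. std_normal_density (x / r i)) \<longlonglongrightarrow> c" by (simp add: c_def)
    qed
    show "integrable lborel (\<lambda>x. (norm (g x))\<^sup>2 * c)"
      by (rule integrable_monotone_convergence[OF i m l lim]) measurable
    show "(LINT x|lborel. (norm (g x))\<^sup>2 * c) = 1 / (2 * pi) * (LINT \<eta>|lborel. c * (norm (\<phi> \<eta>))\<^sup>2)"
      by (rule integral_monotone_convergence[OF i m l lim]) measurable
  qed
  show "integrable lborel (\<lambda>x. (norm (inverse_fourier \<phi> x))\<^sup>2)"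
    using mc(1) c by (simp add: g_def)
  show "(LINT x|lborel. (norm (inverse_fourier \<phi> x))\<^sup>2) = 1 / (2 * pi) * (LINT \<eta>|lborel. (norm (\<phi> \<eta>))\<^sup>2)"
  proof -
    have "c * (LINT x|lborel. (norm (g x))\<^sup>2) = c * (1 / (2 * pi) * (LINT \<eta>|lborel. (norm (\<phi> \<eta>))\<^sup>2))"
      using mc(2) by (simp add: mult.commute)
    then show ?thesis using c unfolding g_def by (simp only: mult_left_cancel order_less_imp_not_eq2 not_False_eq_True)
  qed
qed

text \<open>The transform of the third derivative is \<open>(\<i> \<xi>)\<^sup>3\<close> times the transform of the function, and both
are bounded by \<open>L\<^sup>1\<close> norms; \<open>(1 + a)\<^sup>3 \<le> 4 (1 + a\<^sup>3)\<close> combines the two bounds. The constant depends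
only on \<open>C\<close> and \<open>\<delta>\<close>, so the estimate is uniform in time along a solution.\<close>

lemma norm_fourier_decay:
  assumes deriv: "\<And>k x. k < 3 \<Longrightarrow> (f k has_vector_derivative f (Suc k) x) (at x)"
    and cont: "\<And>x. isCont (f 3) x"
    and bound: "\<And>k x. k \<le> 3 \<Longrightarrow> norm (f k x) \<le> C * weight \<delta> x" and \<delta>: "0 < \<delta>"
  shows "norm (fourier (f 0) \<xi>) \<le> 8 * C * (LINT x|lborel. weight \<delta> x) * weight 2 \<xi>"
proof -
  define J where "J = C * (LINT x|lborel. weight \<delta> x)"
  have contk: "isCont (f k) x" if "k \<le> 3" for k x
    using that cont deriv[of k x] has_vector_derivative_continuous[of "f k"] by (cases "k = 3") auto
  have int: "integrable lborel (f k)" if "k \<le> 3" for k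
    by (rule integrable_weight_bound[OF \<delta> _ bound[OF that]])
       (use contk[OF that] in \<open>auto intro!: borel_measurable_continuous_onI continuous_at_imp_continuous_on\<close>)
  have lim: "(f k \<longlongrightarrow> 0) F" if "k \<le> 3" "(weight \<delta> \<longlongrightarrow> 0) F" for k F
    by (rule Lim_null_comparison[OF _ tendsto_mult_right_zero[OF that(2), of C]])
       (use bound[OF that(1)] in auto)
  have J: "norm (fourier (f k) \<xi>) \<le> J" if "k \<le> 3" for k
  proof -
    have "(LINT x|lborel. norm (f k x)) \<le> (LINT x|lborel. C * weight \<delta> x)"
      by (rule integral_mono) (use int[OF that] bound[OF that] integrable_weight[OF \<delta>] in auto)
    then show ?thesis using norm_fourier_le[of "f k" \<xi>] by (simp add: J_def)
  qed
  have step: "fourier (f (Suc k)) \<xi> = \<i> * \<xi> * fourier (f k) \<xi>" if "k < 3" for k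
    using that by (intro fourier_derivative deriv contk int lim tendsto_weight \<delta>) auto
  have "fourier (f 3) \<xi> = (\<i> * \<xi>) ^ 3 * fourier (f 0) \<xi>"
    using step[of 0] step[of 1] step[of 2] by (simp add: numeral_eq_Suc power_Suc mult.assoc)
  then have f3: "\<bar>\<xi>\<bar> ^ 3 * norm (fourier (f 0) \<xi>) \<le> J"
    using J[of 3] by (simp add: norm_mult norm_power)
  have "(1 + \<bar>\<xi>\<bar>) ^ 3 \<le> 4 * (1 + \<bar>\<xi>\<bar> ^ 3)"
  proof -
    have "0 \<le> 3 * (\<bar>\<xi>\<bar> + 1) * (\<bar>\<xi>\<bar> - 1)\<^sup>2" by simp
    then show ?thesis by (simp add: algebra_simps power2_eq_square power3_eq_cube)
  qed
  then have "(1 + \<bar>\<xi>\<bar>) ^ 3 * norm (fourier (f 0) \<xi>) \<le> 4 * (1 + \<bar>\<xi>\<bar> ^ 3) * norm (fourier (f 0) \<xi>)"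
    by (rule mult_right_mono) simp
  also have "\<dots> \<le> 8 * J"
    using f3 J[of 0] by (simp add: algebra_simps)
  finally have "norm (fourier (f 0) \<xi>) \<le> 8 * J / (1 + \<bar>\<xi>\<bar>) ^ 3"
    by (simp add: pos_le_divide_eq mult.commute)
  also have "1 / (1 + \<bar>\<xi>\<bar>) ^ 3 = weight 2 \<xi>"
    by (simp add: weight_def powr_minus divide_inverse powr_numeral)
  then have "8 * J / (1 + \<bar>\<xi>\<bar>) ^ 3 = 8 * J * weight 2 \<xi>"
    by (metis divide_inverse mult_1 inverse_eq_divide)
  finally show ?thesis by (simp add: J_def algebra_simps)
qed

text \<open>Splitting the integral requires the symbol to be integrable against both transforms. This follows
from integrability against the transform of \<open>f\<close>, because the transform of \<open>Re f\<close> at \<open>\<xi>\<close> averages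
that of \<open>f\<close> at \<open>\<xi>\<close> and its conjugate at \<open>- \<xi>\<close>, and the symbol is even.\<close>

lemma fourier_multiplier_Re_Im:
  assumes f: "integrable lborel f" and mf: "integrable lborel (\<lambda>\<xi>. m \<xi> * fourier f \<xi>)"
    and even: "\<And>\<xi>. m (- \<xi>) = m \<xi>"
  shows "fourier_multiplier m f x = fourier_multiplier m (\<lambda>y. complex_of_real (Re (f y))) x
      + \<i> * fourier_multiplier m (\<lambda>y. complex_of_real (Im (f y))) x"
proof -
  let ?v = "\<lambda>y. complex_of_real (Re (f y))" and ?w = "\<lambda>y. complex_of_real (Im (f y))"
  have int: "integrable lborel ?v" "integrable lborel ?w"
    using f by auto
  have "?v = (\<lambda>y. 1 / 2 * (f y + cnj (f y)))"
    by (simp add: fun_eq_iff complex_add_cnj)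
  then have "fourier ?v \<xi> = 1 / 2 * fourier (\<lambda>y. f y + cnj (f y)) \<xi>" for \<xi>
    by (simp only: fourier_cmult)
  then have v: "fourier ?v \<xi> = 1 / 2 * (fourier f \<xi> + cnj (fourier f (- \<xi>)))" for \<xi>
    using f by (simp add: fourier_add fourier_cnj)
  have "integrable lborel (\<lambda>\<xi>. m (0 + (- 1) * \<xi>) * fourier f (0 + (- 1) * \<xi>))"
    using mf by (rule lborel_integrable_real_affine) simp
  then have "integrable lborel (\<lambda>\<xi>. cnj (m \<xi> * fourier f (- \<xi>)))"
    by (simp add: even del: complex_cnj_mult)
  with mf have mv: "integrable lborel (\<lambda>\<xi>. m \<xi> * fourier ?v \<xi>)"
    by (simp add: v algebra_simps add_divide_distrib)
  have vw: "fourier f \<xi> = fourier ?v \<xi> + \<i> * fourier ?w \<xi>" for \<xi>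
  proof -
    have "fourier (\<lambda>y. ?v y + \<i> * ?w y) \<xi> = fourier ?v \<xi> + \<i> * fourier ?w \<xi>"
      using int by (simp add: fourier_add fourier_cmult)
    then show ?thesis by (simp flip: complex_eq)
  qed
  have "integrable lborel (\<lambda>\<xi>. - \<i> * (m \<xi> * fourier f \<xi> - m \<xi> * fourier ?v \<xi>))"
    using mf mv by auto
  then have mw: "integrable lborel (\<lambda>\<xi>. m \<xi> * fourier ?w \<xi>)"
    by (simp add: vw algebra_simps)
  have "(LINT \<xi>|lborel. m \<xi> * fourier ?v \<xi> * iexp (\<xi> * x) + \<i> * (m \<xi> * fourier ?w \<xi> * iexp (\<xi> * x)))
      = (LINT \<xi>|lborel. m \<xi> * fourier ?v \<xi> * iexp (\<xi> * x)) + (LINT \<xi>|lborel. \<i> * (m \<xi> * fourier ?w \<xi> * iexp (\<xi> * x)))"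
    using integrable_times_iexp[OF mv, of "\<lambda>\<xi>. \<xi> * x"] integrable_times_iexp[OF mw, of "\<lambda>\<xi>. \<xi> * x"]
    by (intro Bochner_Integration.integral_add integrable_mult_right) auto
  moreover have "m \<xi> * fourier f \<xi> * iexp (\<xi> * x)
      = m \<xi> * fourier ?v \<xi> * iexp (\<xi> * x) + \<i> * (m \<xi> * fourier ?w \<xi> * iexp (\<xi> * x))" for \<xi>
    by (simp add: vw algebra_simps)
  ultimately have "(LINT \<xi>|lborel. m \<xi> * fourier f \<xi> * iexp (\<xi> * x))
      = (LINT \<xi>|lborel. m \<xi> * fourier ?v \<xi> * iexp (\<xi> * x)) + \<i> * (LINT \<xi>|lborel. m \<xi> * fourier ?w \<xi> * iexp (\<xi> * x))"
    by (simp only: integral_mult_right_zero)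
  then show ?thesis
    by (simp only: fourier_multiplier_def) (simp add: algebra_simps)
qed

section \<open>Solutions of the fractional Schroedinger equation and their invariants\<close>

locale fnls =
  fixes s \<sigma> :: real and u :: "real \<Rightarrow> real \<Rightarrow> complex"
  assumes s: "0 < s" "s < 1" and \<sigma>: "0 < \<sigma>"
    and smooth: "sufficiently_smooth u"
    and decaying: "sufficiently_decaying u"
    and solution: "fnls_solution s \<sigma> u"
begin

definition nonlin :: "real \<Rightarrow> real \<Rightarrow> complex" where
  "nonlin t x = complex_of_real (cmod (u t x) powr (2 * \<sigma>)) * u t x"

text \<open>The decay hypothesis grants each function its own constants; the largest \<open>C\<close> and the smallest
\<open>\<delta>\<close> serve all of them.\<close>

lemma uniform_bound:
  assumes "0 < a" "a < b"
  obtains C \<delta> where "0 \<le> C" "0 < \<delta>"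
    and "\<And>t x. t \<in> {a..b} \<Longrightarrow> cmod (dt u t x) \<le> C * weight \<delta> x"
    and "\<And>t x k. t \<in> {a..b} \<Longrightarrow> k \<le> 3 \<Longrightarrow> cmod ((dx ^^ k) u t x) \<le> C * weight \<delta> x"
proof -
  \<comment> \<open>The time derivative is listed as entry 4, after the four spatial derivatives 0 to 3.\<close>
  define f where "f k = (if k = 4 then dt u else (dx ^^ k) u)" for k :: nat
  have "\<forall>k\<in>{..4}. \<exists>C \<delta>. 0 < \<delta> \<and> (\<forall>t\<in>{a..b}. \<forall>x. cmod (f k t x) \<le> C * weight \<delta> x)"
  proof
    fix k :: nat assume "k \<in> {..4}"
    then have "decays_on {a..b} (f k)"
      using decaying assms by (auto simp: f_def sufficiently_decaying_def)
    then show "\<exists>C \<delta>. 0 < \<delta> \<and> (\<forall>t\<in>{a..b}. \<forall>x. cmod (f k t x) \<le> C * weight \<delta> x)"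
      by (auto simp: decays_on_def weight_def)
  qed
  from bchoice[OF this] obtain C where
    "\<forall>k\<in>{..4}. \<exists>\<delta>. 0 < \<delta> \<and> (\<forall>t\<in>{a..b}. \<forall>x. cmod (f k t x) \<le> C k * weight \<delta> x)" by blast
  from bchoice[OF this] obtain \<delta> where
    \<delta>: "\<forall>k\<in>{..4}. 0 < \<delta> k \<and> (\<forall>t\<in>{a..b}. \<forall>x. cmod (f k t x) \<le> C k * weight (\<delta> k) x)" by blast
  have C: "\<And>k. k \<le> 4 \<Longrightarrow> 0 < \<delta> k"
      "\<And>k t x. k \<le> 4 \<Longrightarrow> t \<in> {a..b} \<Longrightarrow> cmod (f k t x) \<le> C k * weight (\<delta> k) x"
    using \<delta> by (auto simp del: atLeastAtMost_iff)
  define \<delta>0 where "\<delta>0 = Min (\<delta> ` {..4})"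
  define C0 where "C0 = (\<Sum>k\<le>4. \<bar>C k\<bar>)"
  have bnd: "cmod (f k t x) \<le> C0 * weight \<delta>0 x" if "k \<le> 4" "t \<in> {a..b}" for k t x
  proof -
    have "C k \<le> C0"
      unfolding C0_def using member_le_sum[of k "{..4}" "\<lambda>k. \<bar>C k\<bar>"] that by auto
    moreover have "weight (\<delta> k) x \<le> weight \<delta>0 x"
      unfolding \<delta>0_def by (rule weight_antimono) (use that in auto)
    moreover have "0 \<le> C0" by (simp add: C0_def sum_nonneg)
    ultimately have "C k * weight (\<delta> k) x \<le> C0 * weight \<delta>0 x"
      by (intro mult_mono) auto
    then show ?thesis using C(2)[OF that, of x] by simp
  qed
  show ?thesis
  proof (rule that[of C0 \<delta>0])
    show "cmod (dt u t x) \<le> C0 * weight \<delta>0 x" if "t \<in> {a..b}" for t x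
      using bnd[of 4 t x] that by (simp add: f_def)
    show "cmod ((dx ^^ k) u t x) \<le> C0 * weight \<delta>0 x" if "t \<in> {a..b}" "k \<le> 3" for t x k
      using bnd[of k t x] that by (simp add: f_def)
  qed (use C(1) in \<open>auto simp: C0_def \<delta>0_def sum_nonneg\<close>)
qed

lemma has_vector_derivative_dt:
  "0 < t \<Longrightarrow> ((\<lambda>\<tau>. u \<tau> x) has_vector_derivative dt u t x) (at t)"
  using smooth unfolding sufficiently_smooth_def dt_def vector_derivative_works by blast

lemma has_vector_derivative_dx_power:
  assumes "0 < t" "k < 3"
  shows "((dx ^^ k) u t has_vector_derivative (dx ^^ Suc k) u t x) (at x)"
proof -
  have "(dx ^^ k) u t differentiable (at x)"
    using smooth assms unfolding sufficiently_smooth_def by blast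
  then show ?thesis
    by (simp add: dx_def vector_derivative_works)
qed

lemma isCont_dx_power:
  assumes "0 < t" "k \<le> 3"
  shows "isCont ((dx ^^ k) u t) x"
proof (cases "k = 3")
  case True
  then show ?thesis
    using smooth assms unfolding sufficiently_smooth_def by (simp add: continuous_on_eq_continuous_at)
next
  case False
  then show ?thesis
    using has_vector_derivative_dx_power[OF assms(1), of k x] assms has_vector_derivative_continuous by auto
qed

lemma has_vector_derivative_dx: "0 < t \<Longrightarrow> (u t has_vector_derivative dx u t x) (at x)"
  using has_vector_derivative_dx_power[of t 0 x] by simp

lemma isCont_u: "0 < t \<Longrightarrow> isCont (u t) x" and isCont_dx: "0 < t \<Longrightarrow> isCont (dx u t) x"
  using isCont_dx_power[of t 0] isCont_dx_power[of t 1] by auto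

lemma u_measurable [measurable]: "0 < t \<Longrightarrow> u t \<in> borel_measurable borel"
  and dx_measurable [measurable]: "0 < t \<Longrightarrow> dx u t \<in> borel_measurable borel"
  using isCont_u isCont_dx
  by (auto intro!: borel_measurable_continuous_onI continuous_at_imp_continuous_on)

lemma nonlin_measurable [measurable]: "0 < t \<Longrightarrow> nonlin t \<in> borel_measurable borel"
  unfolding nonlin_def[abs_def] by measurable

lemma bound_at:
  assumes t: "0 < t"
  obtains C \<delta> where "0 \<le> C" "0 < \<delta>"
    and "\<And>x. cmod (u t x) \<le> C * weight \<delta> x" "\<And>x. cmod (dx u t x) \<le> C * weight \<delta> x"
    and "\<And>x. cmod (u t x) \<le> C" "\<And>x. cmod (dx u t x) \<le> C"
proof -
  obtain C \<delta> where C: "0 \<le> C" "0 < \<delta>"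
    and b: "\<And>r x k. r \<in> {t..2 * t} \<Longrightarrow> k \<le> 3 \<Longrightarrow> cmod ((dx ^^ k) u r x) \<le> C * weight \<delta> x"
    by (rule uniform_bound[of t "2 * t"], use t in simp, use t in simp) blast
  have w: "C * weight \<delta> x \<le> C" for x
    using mult_left_mono[OF weight_le_1[OF C(2), of x] C(1)] by simp
  have le: "cmod (u t x) \<le> C * weight \<delta> x" "cmod (dx u t x) \<le> C * weight \<delta> x" for x
    using b[of t 0 x] b[of t 1 x] t by simp_all
  show ?thesis
    by (rule that[OF C le order_trans[OF le(1) w] order_trans[OF le(2) w]])
qed

lemma integrable_u: "0 < t \<Longrightarrow> integrable lborel (u t)"
  and integrable_dx: "0 < t \<Longrightarrow> integrable lborel (dx u t)"
proof -
  assume t: "0 < t"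
  obtain C \<delta> where C: "0 < \<delta>" "\<And>x. cmod (u t x) \<le> C * weight \<delta> x" "\<And>x. cmod (dx u t x) \<le> C * weight \<delta> x"
    by (rule bound_at[OF t]) blast
  show "integrable lborel (u t)" "integrable lborel (dx u t)"
    using t by (auto intro!: integrable_weight_bound[OF C(1) _ C(2)] integrable_weight_bound[OF C(1) _ C(3)])
qed

lemma nonlin_le: "cmod (u t x) \<le> C \<Longrightarrow> cmod (nonlin t x) \<le> C powr (2 * \<sigma>) * cmod (u t x)"
  using \<sigma> by (auto simp: nonlin_def norm_mult intro!: mult_right_mono powr_mono2)

lemma integrable_nonlin:
  assumes "0 < t"
  shows "integrable lborel (nonlin t)"
proof -
  obtain C where C: "\<And>x. cmod (u t x) \<le> C" by (rule bound_at[OF assms]) blast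
  show ?thesis
    by (rule Bochner_Integration.integrable_bound[OF integrable_mult_right[OF integrable_norm[OF integrable_u[OF assms]], of "C powr (2 * \<sigma>)"]])
       (use assms nonlin_le[OF C] in auto)
qed

lemma fourier_u_decay:
  assumes "0 < a" "a < b"
  obtains D where "0 \<le> D" "\<And>t \<xi>. t \<in> {a..b} \<Longrightarrow> cmod (fourier (u t) \<xi>) \<le> D * weight 2 \<xi>"
proof -
  obtain C \<delta> where C: "0 \<le> C" "0 < \<delta>"
    and b: "\<And>r x k. r \<in> {a..b} \<Longrightarrow> k \<le> 3 \<Longrightarrow> cmod ((dx ^^ k) u r x) \<le> C * weight \<delta> x"
    by (rule uniform_bound[OF assms]) blast
  show ?thesis
  proof (rule that)
    show "0 \<le> 8 * C * (LINT x|lborel. weight \<delta> x)"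
      using C by (auto intro: Bochner_Integration.integral_nonneg)
    show "cmod (fourier (u t) \<xi>) \<le> 8 * C * (LINT x|lborel. weight \<delta> x) * weight 2 \<xi>" if "t \<in> {a..b}" for t \<xi>
      using norm_fourier_decay[of "\<lambda>k. (dx ^^ k) u t" C \<delta> \<xi>] has_vector_derivative_dx_power isCont_dx_power b[OF that] C that assms
      by auto
  qed
qed

text \<open>Symbols are compared with \<open>(1 + |\<xi>|) powr \<alpha>\<close> rather than \<open>|\<xi>| powr \<alpha>\<close> so that the constant symbol
of the mass has order \<open>0\<close> without an exception at the origin.\<close>

definition symbol_of_order :: "real \<Rightarrow> (real \<Rightarrow> real) \<Rightarrow> bool" where
  "symbol_of_order \<alpha> m \<longleftrightarrow> m \<in> borel_measurable borel \<and> (\<forall>\<xi>. \<bar>m \<xi>\<bar> \<le> (1 + \<bar>\<xi>\<bar>) powr \<alpha>)"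

lemma symbol_fourier_bound:
  assumes "symbol_of_order \<alpha> m" and "norm z \<le> D * weight 2 \<xi>" and "0 \<le> D"
  shows "\<bar>m \<xi>\<bar> * norm z \<le> D * weight (2 - \<alpha>) \<xi>"
proof -
  have "\<bar>m \<xi>\<bar> * norm z \<le> (1 + \<bar>\<xi>\<bar>) powr \<alpha> * (D * weight 2 \<xi>)"
    using assms by (intro mult_mono) (auto simp: symbol_of_order_def)
  then show ?thesis by (simp add: weight_mult_powr[symmetric] mult_ac)
qed

lemma symbol_fourier:
  assumes t: "0 < t" and m: "symbol_of_order \<alpha> m" and \<alpha>: "\<alpha> < 2"
  shows "integrable lborel (\<lambda>\<xi>. m \<xi> * fourier (u t) \<xi>)"
    and "\<exists>B. \<forall>\<xi>. cmod (m \<xi> * fourier (u t) \<xi>) \<le> B"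
proof -
  have [measurable]: "m \<in> borel_measurable borel" using m by (simp add: symbol_of_order_def)
  obtain D where D: "0 \<le> D" "\<And>r \<xi>. r \<in> {t..2 * t} \<Longrightarrow> cmod (fourier (u r) \<xi>) \<le> D * weight 2 \<xi>"
    by (rule fourier_u_decay[of t "2 * t"], use t in simp, use t in simp) blast
  have b: "cmod (m \<xi> * fourier (u t) \<xi>) \<le> D * weight (2 - \<alpha>) \<xi>" for \<xi>
    using symbol_fourier_bound[OF m D(2) D(1), of t \<xi>] t by (simp add: norm_mult)
  show "integrable lborel (\<lambda>\<xi>. m \<xi> * fourier (u t) \<xi>)"
    by (rule integrable_weight_bound[OF _ _ b]) (use t \<alpha> in auto)
  have "D * weight (2 - \<alpha>) \<xi> \<le> D" for \<xi>
    using mult_left_mono[OF weight_le_1[of "2 - \<alpha>" \<xi>] D(1)] \<alpha> by simp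
  then show "\<exists>B. \<forall>\<xi>. cmod (m \<xi> * fourier (u t) \<xi>) \<le> B"
    using b order_trans by blast
qed

lemma symbol_of_order_1: "symbol_of_order 0 (\<lambda>_. 1)"
  by (auto simp: symbol_of_order_def)

lemma symbol_of_order_id: "symbol_of_order 1 (\<lambda>\<xi>. \<xi>)"
  by (simp add: symbol_of_order_def)

lemma symbol_of_order_powr: "0 \<le> \<alpha> \<Longrightarrow> symbol_of_order \<alpha> (\<lambda>\<xi>. \<bar>\<xi>\<bar> powr \<alpha>)"
  by (auto simp: symbol_of_order_def intro!: powr_mono2)

lemma integrable_fourier_u: "0 < t \<Longrightarrow> integrable lborel (fourier (u t))"
  using symbol_fourier(1)[OF _ symbol_of_order_1] by simp

lemma fourier_multiplier_1:
  assumes "0 < t"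
  shows "fourier_multiplier (\<lambda>_. 1) (u t) = u t"
proof
  fix x
  obtain C where "\<And>x. cmod (u t x) \<le> C" by (rule bound_at[OF assms]) blast
  from inverse_fourier_fourier[OF integrable_u[OF assms] this isCont_u[OF assms] integrable_fourier_u[OF assms]]
  show "fourier_multiplier (\<lambda>_. 1) (u t) x = u t x" by (simp add: fourier_multiplier_eq)
qed

lemma fourier_multiplier_id:
  assumes t: "0 < t"
  shows "fourier_multiplier (\<lambda>\<xi>. \<xi>) (u t) = (\<lambda>x. - \<i> * dx u t x)"
proof
  fix x
  obtain C \<delta> where C: "0 < \<delta>" "\<And>x. cmod (u t x) \<le> C * weight \<delta> x" "\<And>x. cmod (dx u t x) \<le> C"
    by (rule bound_at[OF t]) blast
  have lim: "(u t \<longlongrightarrow> 0) F" if "(weight \<delta> \<longlongrightarrow> 0) F" for F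
    by (rule Lim_null_comparison[OF _ tendsto_mult_right_zero[OF that, of C]]) (use C in auto)
  have "fourier (dx u t) \<xi> = \<i> * \<xi> * fourier (u t) \<xi>" for \<xi>
    by (rule fourier_derivative)
       (use t C in \<open>auto intro!: has_vector_derivative_dx isCont_dx integrable_u integrable_dx lim tendsto_weight\<close>)
  then have F: "fourier (\<lambda>x. - \<i> * dx u t x) = (\<lambda>\<xi>. \<xi> * fourier (u t) \<xi>)"
    by (intro ext, simp only: fourier_cmult) (simp add: mult.assoc[symmetric])
  have "inverse_fourier (fourier (\<lambda>x. - \<i> * dx u t x)) x = - \<i> * dx u t x"
  proof (rule inverse_fourier_fourier)
    show "integrable lborel (\<lambda>x. - \<i> * dx u t x)"
      using integrable_dx[OF t] by (rule integrable_mult_right)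
    show "isCont (\<lambda>x. - \<i> * dx u t x) x"
      using isCont_dx[OF t] by (intro continuous_intros)
    show "integrable lborel (fourier (\<lambda>x. - \<i> * dx u t x))"
      unfolding F using symbol_fourier(1)[OF t symbol_of_order_id] by simp
  qed (use C in \<open>simp add: norm_mult\<close>)
  then show "fourier_multiplier (\<lambda>\<xi>. \<xi>) (u t) x = - \<i> * dx u t x"
    by (simp only: fourier_multiplier_eq F)
qed

text \<open>The equation itself exhibits \<open>(-\<partial>\<^sub>x\<^sub>x)\<^sup>s u\<close> as a sum of integrable functions; its integrability is
not visible from the multiplier, whose symbol is not smooth at the origin.\<close>

lemma frac_laplacian_u:
  assumes "0 < t"
  shows "frac_laplacian s (u t) = (\<lambda>x. \<i> * dt u t x + nonlin t x)"
proof
  fix x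
  have "\<i> * dt u t x - frac_laplacian s (u t) x + nonlin t x = 0"
    using solution assms unfolding fnls_solution_def nonlin_def by blast
  then show "frac_laplacian s (u t) x = \<i> * dt u t x + nonlin t x"
    by (simp add: algebra_simps)
qed

text \<open>Differentiation under the integral, on a time interval around \<open>t\<close> that stays away from \<open>0\<close>. The
case \<open>\<xi> = 0\<close> yields integrability of the time derivative.\<close>

lemma fourier_dt:
  assumes t: "0 < t"
  shows "integrable lborel (dt u t)"
    and "((\<lambda>\<tau>. fourier (u \<tau>) \<xi>) has_vector_derivative fourier (dt u t) \<xi>) (at t)"
proof -
  obtain C \<delta> where C: "0 \<le> C" "0 < \<delta>"
    and b: "\<And>r x. r \<in> {t / 2..2 * t} \<Longrightarrow> cmod (dt u r x) \<le> C * weight \<delta> x"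
    by (rule uniform_bound[of "t / 2" "2 * t"], use t in simp, use t in simp) blast
  have *: "integrable lborel (\<lambda>x. dt u t x * iexp (- (\<xi> * x))) \<and>
     ((\<lambda>\<tau>. LINT x|lborel. u \<tau> x * iexp (- (\<xi> * x))) has_vector_derivative
       (LINT x|lborel. dt u t x * iexp (- (\<xi> * x)))) (at t)" for \<xi>
  proof -
    note L = has_vector_derivative_integral[of t "t / 2" "2 * t" "\<lambda>\<tau> x. u \<tau> x * iexp (- (\<xi> * x))"
        "\<lambda>\<tau> x. dt u \<tau> x * iexp (- (\<xi> * x))" lborel "\<lambda>x. C * weight \<delta> x"]
    have 1: "((\<lambda>r. u r x * iexp (- (\<xi> * x))) has_vector_derivative dt u \<tau> x * iexp (- (\<xi> * x))) (at \<tau>)"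
      if "\<tau> \<in> {t / 2<..<2 * t}" for \<tau> x
      by (rule has_vector_derivative_mult_left, rule has_vector_derivative_dt) (use that t in auto)
    have 2: "integrable lborel (\<lambda>x. u \<tau> x * iexp (- (\<xi> * x)))" if "\<tau> \<in> {t / 2<..<2 * t}" for \<tau>
      using integrable_times_iexp[OF integrable_u, of \<tau> "\<lambda>x. - (\<xi> * x)"] that t by simp
    have 3: "norm (dt u \<tau> x * iexp (- (\<xi> * x))) \<le> C * weight \<delta> x" if "\<tau> \<in> {t / 2<..<2 * t}" for \<tau> x
      using b[of \<tau> x] that by (simp add: norm_mult)
    have 4: "integrable lborel (\<lambda>x. C * weight \<delta> x)"
      using integrable_weight[OF C(2)] by simp
    have 5: "t \<in> {t / 2<..<2 * t}" using t by simp
    show ?thesis using L[OF 5 1 2 3 4] by blast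
  qed
  show "integrable lborel (dt u t)" using *[of 0] by simp
  show "((\<lambda>\<tau>. fourier (u \<tau>) \<xi>) has_vector_derivative fourier (dt u t) \<xi>) (at t)"
    using * unfolding fourier_def by blast
qed

lemma fourier_dt_bound:
  assumes "0 < a" "a < b"
  obtains E where "0 \<le> E" "\<And>t \<xi>. t \<in> {a..b} \<Longrightarrow> cmod (fourier (dt u t) \<xi>) \<le> E"
proof -
  obtain C \<delta> where C: "0 \<le> C" "0 < \<delta>"
    and b: "\<And>r x. r \<in> {a..b} \<Longrightarrow> cmod (dt u r x) \<le> C * weight \<delta> x"
    by (rule uniform_bound[OF assms]) blast
  show ?thesis
  proof (rule that)
    show "0 \<le> C * (LINT x|lborel. weight \<delta> x)"
      using C by (auto intro: Bochner_Integration.integral_nonneg)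
    show "cmod (fourier (dt u t) \<xi>) \<le> C * (LINT x|lborel. weight \<delta> x)" if "t \<in> {a..b}" for t \<xi>
    proof -
      have "(LINT x|lborel. cmod (dt u t x)) \<le> (LINT x|lborel. C * weight \<delta> x)"
        by (rule integral_mono) (use b[OF that] fourier_dt(1)[of t] that assms integrable_weight[OF C(2)] in auto)
      then show ?thesis using norm_fourier_le[of "dt u t" \<xi>] by simp
    qed
  qed
qed

lemma isCont_powr_abs: "0 < \<alpha> \<Longrightarrow> isCont (\<lambda>\<xi>::real. \<bar>\<xi>\<bar> powr \<alpha>) x"
  by (auto simp: isCont_def intro!: tendsto_powr' tendsto_intros)

text \<open>The equation on the frequency side. The inversion theorem may be applied to \<open>(-\<partial>\<^sub>x\<^sub>x)\<^sup>s u\<close> because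
that function is integrable by \<open>frac_laplacian_u\<close> and \<open>fourier_dt\<close>.\<close>

lemma fourier_dt_eq:
  assumes t: "0 < t"
  shows "fourier (dt u t) \<xi> = \<i> * (fourier (nonlin t) \<xi> - \<bar>\<xi>\<bar> powr (2 * s) * fourier (u t) \<xi>)"
proof -
  let ?m = "\<lambda>\<xi>. \<bar>\<xi>\<bar> powr (2 * s)"
  have m: "symbol_of_order (2 * s) ?m" and \<alpha>: "2 * s < 2"
    using symbol_of_order_powr[of "2 * s"] s by auto
  obtain B where B: "\<And>\<xi>. cmod (?m \<xi> * fourier (u t) \<xi>) \<le> B"
    using symbol_fourier(2)[OF t m \<alpha>] by blast
  have i: "integrable lborel (\<lambda>x. \<i> * dt u t x)" using fourier_dt(1)[OF t] by (rule integrable_mult_right)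
  have "fourier (frac_laplacian s (u t)) \<xi> = ?m \<xi> * fourier (u t) \<xi>"
    unfolding frac_laplacian_def
  proof (rule fourier_fourier_multiplier[OF symbol_fourier(1)[OF t m \<alpha>] B])
    show "isCont (\<lambda>\<xi>. ?m \<xi> * fourier (u t) \<xi>) \<xi>"
      using isCont_powr_abs[of "2 * s" \<xi>] s isCont_fourier[OF integrable_u[OF t]]
      by (intro continuous_intros) auto
    show "integrable lborel (fourier_multiplier ?m (u t))"
      using frac_laplacian_u[OF t] i integrable_nonlin[OF t] unfolding frac_laplacian_def by simp
  qed
  moreover have "fourier (frac_laplacian s (u t)) \<xi> = \<i> * fourier (dt u t) \<xi> + fourier (nonlin t) \<xi>"
    unfolding frac_laplacian_u[OF t] using fourier_add[OF i integrable_nonlin[OF t]] by (simp add: fourier_cmult)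
  ultimately have "\<i> * fourier (dt u t) \<xi> = ?m \<xi> * fourier (u t) \<xi> - fourier (nonlin t) \<xi>"
    by (simp add: algebra_simps)
  then have "- \<i> * (\<i> * fourier (dt u t) \<xi>) = - \<i> * (?m \<xi> * fourier (u t) \<xi> - fourier (nonlin t) \<xi>)"
    by (simp only:)
  then show ?thesis by (simp add: algebra_simps flip: mult.assoc)
qed

text \<open>All three balance laws come from this identity. Differentiating the squared modulus of the
transform with \<open>fourier_dt_eq\<close>, the linear part contributes the real part of a purely imaginary
number, \<open>- \<i> |\<xi>| powr (2 * s)\<close> times that squared modulus; Parseval turns the contribution of the
nonlinearity back into an integral over space. The differentiation is legitimate since the time
derivative of the transform is bounded while the transform itself decays like \<open>weight 2\<close>.\<close>

lemma spectral_derivative: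
  assumes t: "0 < t" and m: "symbol_of_order \<alpha> m" and \<alpha>: "\<alpha> < 2"
  shows "integrable lborel (\<lambda>\<xi>. m \<xi> * (cmod (fourier (u t) \<xi>))\<^sup>2)"
    and "((\<lambda>\<tau>. LINT \<xi>|lborel. m \<xi> * (cmod (fourier (u \<tau>) \<xi>))\<^sup>2) has_real_derivative
       4 * pi * Im (LINT x|lborel. fourier_multiplier m (u t) x * cnj (nonlin t x))) (at t)"
proof -
  let ?J = "{t / 2..2 * t}" and ?I = "{t / 2<..<2 * t}"
  have [measurable]: "m \<in> borel_measurable borel" using m by (simp add: symbol_of_order_def)
  obtain D where D: "0 \<le> D" "\<And>r \<xi>. r \<in> ?J \<Longrightarrow> cmod (fourier (u r) \<xi>) \<le> D * weight 2 \<xi>"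
    by (rule fourier_u_decay[of "t / 2" "2 * t"], use t in simp, use t in simp) blast
  obtain E where E: "0 \<le> E" "\<And>r \<xi>. r \<in> ?J \<Longrightarrow> cmod (fourier (dt u r) \<xi>) \<le> E"
    by (rule fourier_dt_bound[of "t / 2" "2 * t"], use t in simp, use t in simp) blast
  have uD: "cmod (fourier (u r) \<xi>) \<le> D" if "r \<in> ?J" for r \<xi>
    using D(2)[OF that, of \<xi>] mult_left_mono[OF weight_le_1[of 2 \<xi>] D(1)] by simp
  let ?F = "\<lambda>r \<xi>. m \<xi> * (cmod (fourier (u r) \<xi>))\<^sup>2"
  let ?F' = "\<lambda>r \<xi>. m \<xi> * (2 * Re (fourier (dt u r) \<xi> * cnj (fourier (u r) \<xi>)))"
  have tI: "t \<in> ?I" using t by simp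
  have deriv: "((\<lambda>r. ?F r \<xi>) has_vector_derivative ?F' r \<xi>) (at r)" if "r \<in> ?I" for r \<xi>
    unfolding has_real_derivative_iff_has_vector_derivative[symmetric]
    by (rule DERIV_cmult, rule has_real_derivative_norm_square, rule fourier_dt) (use that t in auto)
  have int: "integrable lborel (?F r)" if r: "r \<in> ?I" for r
  proof (rule integrable_weight_bound[of "2 - \<alpha>" _ "D * D"])
    show "norm (?F r \<xi>) \<le> D * D * weight (2 - \<alpha>) \<xi>" for \<xi>
      using mult_mono[OF symbol_fourier_bound[OF m D(2) D(1), of r \<xi>] uD[of r \<xi>]] r D(1)
      by (simp add: abs_mult power2_eq_square mult_ac)
  qed (use r t \<alpha> in auto)
  have bound: "norm (?F' r \<xi>) \<le> 2 * D * E * weight (2 - \<alpha>) \<xi>" if r: "r \<in> ?I" for r \<xi>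
  proof -
    let ?R = "Re (fourier (dt u r) \<xi> * cnj (fourier (u r) \<xi>))"
    have R: "\<bar>?R\<bar> \<le> E * cmod (fourier (u r) \<xi>)"
      by (rule order_trans[OF abs_Re_le_cmod]) (use E(2)[of r \<xi>] r in \<open>auto simp: norm_mult intro: mult_right_mono\<close>)
    have "norm (?F' r \<xi>) = 2 * \<bar>m \<xi>\<bar> * \<bar>?R\<bar>"
      by (simp only: real_norm_def abs_mult abs_numeral mult_ac)
    also have "\<dots> \<le> 2 * \<bar>m \<xi>\<bar> * (E * cmod (fourier (u r) \<xi>))"
      using R by (rule mult_left_mono) simp
    also have "\<dots> \<le> 2 * E * (D * weight (2 - \<alpha>) \<xi>)"
      using mult_left_mono[OF symbol_fourier_bound[OF m D(2) D(1), of r \<xi>], of "2 * E"] r E(1) by (simp add: mult_ac)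
    finally show ?thesis by (simp add: mult_ac)
  qed
  have w: "integrable lborel (\<lambda>\<xi>. 2 * D * E * weight (2 - \<alpha>) \<xi>)"
    using integrable_weight[of "2 - \<alpha>"] \<alpha> by simp
  show "integrable lborel (?F t)" using int[OF tI] .
  let ?h = "\<lambda>\<xi>. m \<xi> * fourier (u t) \<xi> * cnj (fourier (nonlin t) \<xi>)"
  have h: "integrable lborel ?h"
    by (rule Bochner_Integration.integrable_bound[OF integrable_mult_right[OF
          symbol_fourier(1)[OF t m \<alpha>, THEN integrable_norm], of "LINT x|lborel. cmod (nonlin t x)"]])
       (use t in \<open>auto simp: norm_mult abs_mult mult_ac intro!: mult_left_mono order_trans[OF norm_fourier_le]\<close>)
  have "?F' t \<xi> = 2 * Im (?h \<xi>)" for \<xi>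
    unfolding fourier_dt_eq[OF t] by (simp add: algebra_simps)
  then have "(LINT \<xi>|lborel. ?F' t \<xi>) = (LINT \<xi>|lborel. 2 * Im (?h \<xi>))"
    by (simp only:)
  also have "\<dots> = 2 * Im (LINT \<xi>|lborel. ?h \<xi>)"
    by (simp only: integral_mult_right_zero integral_Im[OF h])
  also have "(LINT \<xi>|lborel. ?h \<xi>) = 2 * pi * (LINT x|lborel. fourier_multiplier m (u t) x * cnj (nonlin t x))"
    using parseval_inverse_fourier[OF symbol_fourier(1)[OF t m \<alpha>] integrable_nonlin[OF t]]
    by (simp add: fourier_multiplier_eq)
  finally have "(LINT \<xi>|lborel. ?F' t \<xi>)
      = 4 * pi * Im (LINT x|lborel. fourier_multiplier m (u t) x * cnj (nonlin t x))"
    by simp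
  with has_vector_derivative_integral(2)[OF tI deriv int bound w]
  show "((\<lambda>\<tau>. LINT \<xi>|lborel. ?F \<tau> \<xi>) has_real_derivative
       4 * pi * Im (LINT x|lborel. fourier_multiplier m (u t) x * cnj (nonlin t x))) (at t)"
    unfolding has_real_derivative_iff_has_vector_derivative by simp
qed

lemma integrable_norm_square:
  assumes t: "0 < t"
  shows "integrable lborel (\<lambda>x. (cmod (u t x))\<^sup>2)"
    and "(LINT x|lborel. (cmod (u t x))\<^sup>2) = 1 / (2 * pi) * (LINT \<xi>|lborel. 1 * (cmod (fourier (u t) \<xi>))\<^sup>2)"
proof -
  obtain B where B: "\<And>\<xi>. cmod (fourier (u t) \<xi>) \<le> B"
    using symbol_fourier(2)[OF t symbol_of_order_1] by auto
  have "inverse_fourier (fourier (u t)) = u t"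
    using fourier_multiplier_1[OF t] by (simp add: fourier_multiplier_eq)
  with inverse_fourier_plancherel[OF integrable_fourier_u[OF t] B isCont_fourier[OF integrable_u[OF t]]]
  show "integrable lborel (\<lambda>x. (cmod (u t x))\<^sup>2)"
    and "(LINT x|lborel. (cmod (u t x))\<^sup>2) = 1 / (2 * pi) * (LINT \<xi>|lborel. 1 * (cmod (fourier (u t) \<xi>))\<^sup>2)"
    by simp_all
qed

lemma momentum_spectral:
  assumes t: "0 < t"
  shows "integrable lborel (\<lambda>x. Im (cnj (u t x) * dx u t x))"
    and "(LINT x|lborel. Im (cnj (u t x) * dx u t x)) = 1 / (2 * pi) * (LINT \<xi>|lborel. \<xi> * (cmod (fourier (u t) \<xi>))\<^sup>2)"
proof -
  obtain C where C: "\<And>x. cmod (u t x) \<le> C"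
    by (rule bound_at[OF t]) blast
  have i: "integrable lborel (\<lambda>x. - \<i> * dx u t x * cnj (u t x))"
    by (rule Bochner_Integration.integrable_bound[OF integrable_mult_right[OF integrable_norm[OF integrable_dx[OF t]], of C]])
       (use t in \<open>auto simp: norm_mult abs_mult mult.commute[of C] intro!: mult_left_mono order_trans[OF C abs_ge_self]\<close>)
  have Re_eq: "Re (- \<i> * dx u t x * cnj (u t x)) = Im (cnj (u t x) * dx u t x)" for x
    by (simp add: algebra_simps)
  show "integrable lborel (\<lambda>x. Im (cnj (u t x) * dx u t x))"
    using integrable_Re[OF i] by (simp only: Re_eq)
  have F: "\<xi> * fourier (u t) \<xi> * cnj (fourier (u t) \<xi>) = complex_of_real (\<xi> * (cmod (fourier (u t) \<xi>))\<^sup>2)" for \<xi>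
    by (simp only: of_real_mult complex_norm_square mult.assoc)
  have "(LINT x|lborel. - \<i> * dx u t x * cnj (u t x))
      = complex_of_real (1 / (2 * pi)) * (LINT \<xi>|lborel. complex_of_real (\<xi> * (cmod (fourier (u t) \<xi>))\<^sup>2))"
    using parseval_inverse_fourier[OF symbol_fourier(1)[OF t symbol_of_order_id] integrable_u[OF t]]
    unfolding fourier_multiplier_eq[symmetric] fourier_multiplier_id[OF t] F by simp
  also have "\<dots> = complex_of_real (1 / (2 * pi) * (LINT \<xi>|lborel. \<xi> * (cmod (fourier (u t) \<xi>))\<^sup>2))"
    by (simp only: integral_complex_of_real flip: of_real_mult)
  finally have "Re (LINT x|lborel. - \<i> * dx u t x * cnj (u t x)) = 1 / (2 * pi) * (LINT \<xi>|lborel. \<xi> * (cmod (fourier (u t) \<xi>))\<^sup>2)"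
    by (simp only: Re_complex_of_real)
  then show "(LINT x|lborel. Im (cnj (u t x) * dx u t x)) = 1 / (2 * pi) * (LINT \<xi>|lborel. \<xi> * (cmod (fourier (u t) \<xi>))\<^sup>2)"
    by (simp only: integral_Re[OF i, symmetric] Re_eq)
qed

lemma kinetic_spectral:
  assumes t: "0 < t"
  shows "integrable lborel (\<lambda>x. (cmod (fourier_multiplier (\<lambda>\<xi>. \<bar>\<xi>\<bar> powr s) (u t) x))\<^sup>2)"
    and "(LINT x|lborel. (cmod (fourier_multiplier (\<lambda>\<xi>. \<bar>\<xi>\<bar> powr s) (u t) x))\<^sup>2)
      = 1 / (2 * pi) * (LINT \<xi>|lborel. \<bar>\<xi>\<bar> powr (2 * s) * (cmod (fourier (u t) \<xi>))\<^sup>2)"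
proof -
  let ?m = "\<lambda>\<xi>::real. \<bar>\<xi>\<bar> powr s"
  have m: "symbol_of_order s ?m" and \<alpha>: "s < 2" using symbol_of_order_powr[of s] s by auto
  obtain B where B: "\<And>\<xi>. cmod (?m \<xi> * fourier (u t) \<xi>) \<le> B"
    using symbol_fourier(2)[OF t m \<alpha>] by blast
  have cont: "isCont (\<lambda>\<xi>. ?m \<xi> * fourier (u t) \<xi>) \<xi>" for \<xi>
    using isCont_powr_abs[of s \<xi>] s isCont_fourier[OF integrable_u[OF t]]
    by (intro continuous_intros) auto
  have sq: "(cmod (?m \<xi> * fourier (u t) \<xi>))\<^sup>2 = \<bar>\<xi>\<bar> powr (2 * s) * (cmod (fourier (u t) \<xi>))\<^sup>2" for \<xi>
    by (simp add: norm_mult power_mult_distrib powr_add[symmetric] power2_eq_square)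
  show "integrable lborel (\<lambda>x. (cmod (fourier_multiplier ?m (u t) x))\<^sup>2)"
    and "(LINT x|lborel. (cmod (fourier_multiplier ?m (u t) x))\<^sup>2)
      = 1 / (2 * pi) * (LINT \<xi>|lborel. \<bar>\<xi>\<bar> powr (2 * s) * (cmod (fourier (u t) \<xi>))\<^sup>2)"
    using inverse_fourier_plancherel[OF symbol_fourier(1)[OF t m \<alpha>] B cont]
    unfolding fourier_multiplier_eq sq by blast+
qed

text \<open>Used in both variables: in time for the potential energy, in space for the total derivative in
the momentum balance.\<close>

lemma DERIV_potential:
  fixes z :: "real \<Rightarrow> complex"
  assumes "(z has_vector_derivative z') (at r)"
  shows "((\<lambda>r. (cmod (z r))\<^sup>2 powr (\<sigma> + 1)) has_real_derivative
      (2 * \<sigma> + 2) * Re (z' * cnj (complex_of_real (cmod (z r) powr (2 * \<sigma>)) * z r))) (at r)"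
proof -
  have "(\<sigma> + 1) * (cmod (z r))\<^sup>2 powr (\<sigma> + 1 - 1) * (2 * Re (z' * cnj (z r)))
      = (2 * \<sigma> + 2) * Re (z' * cnj (complex_of_real (cmod (z r) powr (2 * \<sigma>)) * z r))"
    by (simp add: norm_square_powr algebra_simps)
  with DERIV_powr_nonneg[OF has_real_derivative_norm_square[OF assms], of "\<sigma> + 1"] \<sigma> show ?thesis
    by simp
qed

lemma potential_eq: "(cmod (u t x))\<^sup>2 powr (\<sigma> + 1) = cmod (nonlin t x) * cmod (u t x)"
  by (cases "u t x = 0") (simp_all add: powr_add norm_square_powr nonlin_def norm_mult, simp add: power2_eq_square)

lemma integrable_potential:
  assumes t: "0 < t"
  shows "integrable lborel (\<lambda>x. (cmod (u t x))\<^sup>2 powr (\<sigma> + 1))"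
proof -
  obtain C where C: "\<And>x. cmod (u t x) \<le> C" by (rule bound_at[OF t]) blast
  show ?thesis unfolding potential_eq
    by (rule Bochner_Integration.integrable_bound[OF integrable_mult_right[OF integrable_norm[OF integrable_nonlin[OF t]], of C]])
       (use t in \<open>auto simp: norm_mult abs_mult mult.commute[of C] intro!: mult_left_mono order_trans[OF C abs_ge_self]\<close>)
qed

lemma potential_derivative_dt:
  assumes t: "0 < t"
  shows "((\<lambda>\<tau>. LINT x|lborel. (cmod (u \<tau> x))\<^sup>2 powr (\<sigma> + 1)) has_real_derivative
    (2 * \<sigma> + 2) * (LINT x|lborel. Re (dt u t x * cnj (nonlin t x)))) (at t)"
proof -
  obtain C \<delta> where C: "0 \<le> C" "0 < \<delta>"
    and b: "\<And>r x. r \<in> {t / 2..2 * t} \<Longrightarrow> cmod (dt u r x) \<le> C * weight \<delta> x"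
    and b0: "\<And>r x k. r \<in> {t / 2..2 * t} \<Longrightarrow> k \<le> 3 \<Longrightarrow> cmod ((dx ^^ k) u r x) \<le> C * weight \<delta> x"
    by (rule uniform_bound[of "t / 2" "2 * t"], use t in simp, use t in simp) blast
  let ?I = "{t / 2<..<2 * t}" and ?c = "(2 * \<sigma> + 2) * (C * (C powr (2 * \<sigma>) * C))"
  let ?F' = "\<lambda>r x. (2 * \<sigma> + 2) * Re (dt u r x * cnj (nonlin r x))"
  have tI: "t \<in> ?I" using t by simp
  have deriv: "((\<lambda>r. (cmod (u r x))\<^sup>2 powr (\<sigma> + 1)) has_vector_derivative ?F' r x) (at r)" if "r \<in> ?I" for r x
    unfolding has_real_derivative_iff_has_vector_derivative[symmetric] nonlin_def
    by (rule DERIV_potential, rule has_vector_derivative_dt) (use that t in auto)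
  have int: "integrable lborel (\<lambda>x. (cmod (u r x))\<^sup>2 powr (\<sigma> + 1))" if "r \<in> ?I" for r
    using integrable_potential[of r] that t by simp
  have bound: "norm (?F' r x) \<le> ?c * weight \<delta> x" if r: "r \<in> ?I" for r x
  proof -
    have r': "r \<in> {t / 2..2 * t}" using r by simp
    have uC: "cmod (u r x) \<le> C"
      using b0[OF r', of 0 x] mult_left_mono[OF weight_le_1[OF C(2), of x] C(1)] by simp
    have N: "cmod (nonlin r x) \<le> C powr (2 * \<sigma>) * C"
      using nonlin_le[OF uC] mult_left_mono[OF uC, of "C powr (2 * \<sigma>)"] by simp
    have "\<bar>Re (dt u r x * cnj (nonlin r x))\<bar> \<le> cmod (dt u r x) * cmod (nonlin r x)"
      using abs_Re_le_cmod[of "dt u r x * cnj (nonlin r x)"] by (simp only: norm_mult complex_mod_cnj)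
    also have "\<dots> \<le> (C * weight \<delta> x) * (C powr (2 * \<sigma>) * C)"
      using b[OF r', of x] N C(1) by (intro mult_mono) auto
    finally have "(2 * \<sigma> + 2) * \<bar>Re (dt u r x * cnj (nonlin r x))\<bar> \<le> (2 * \<sigma> + 2) * ((C * weight \<delta> x) * (C powr (2 * \<sigma>) * C))"
      by (rule mult_left_mono) (use \<sigma> in simp)
    moreover have "norm (?F' r x) = (2 * \<sigma> + 2) * \<bar>Re (dt u r x * cnj (nonlin r x))\<bar>"
      using \<sigma> by (simp add: abs_mult)
    ultimately show ?thesis by (simp only: mult_ac)
  qed
  have w: "integrable lborel (\<lambda>x. ?c * weight \<delta> x)"
    using integrable_weight[OF C(2)] by (rule integrable_mult_right)
  from has_vector_derivative_integral(2)[OF tI deriv int bound w] show ?thesis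
    unfolding has_real_derivative_iff_has_vector_derivative by (simp only: integral_mult_right_zero)
qed

text \<open>The integrand is, up to a factor, the spatial derivative of \<open>|u| powr (2 * \<sigma> + 2)\<close>.\<close>

lemma integral_dx_nonlin:
  assumes t: "0 < t"
  shows "(LINT x|lborel. Re (dx u t x * cnj (nonlin t x))) = 0"
proof -
  obtain C \<delta> where C: "0 \<le> C" "0 < \<delta>" "\<And>x. cmod (u t x) \<le> C * weight \<delta> x" "\<And>x. cmod (u t x) \<le> C" "\<And>x. cmod (dx u t x) \<le> C"
    by (rule bound_at[OF t]) blast
  have lim: "((\<lambda>x. (cmod (u t x))\<^sup>2 powr (\<sigma> + 1)) \<longlongrightarrow> 0) F" if F: "(weight \<delta> \<longlongrightarrow> 0) F" for F
  proof -
    have "cmod (u t x) * cmod (nonlin t x) \<le> C * (C powr (2 * \<sigma>) * (C * weight \<delta> x))" for x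
      using C nonlin_le[OF C(4), of x] mult_left_mono[OF C(3)[of x], of "C powr (2 * \<sigma>)"]
      by (intro mult_mono) auto
    then have le: "norm ((cmod (u t x))\<^sup>2 powr (\<sigma> + 1)) \<le> C * (C powr (2 * \<sigma>) * C) * weight \<delta> x" for x
      unfolding potential_eq by (simp add: mult_ac)
    show ?thesis
      by (rule Lim_null_comparison[OF _ tendsto_mult_right_zero[OF F, of "C * (C powr (2 * \<sigma>) * C)"]])
         (use le in auto)
  qed
  let ?f = "\<lambda>x. (2 * \<sigma> + 2) * Re (dx u t x * cnj (nonlin t x))"
  have i: "integrable lborel (\<lambda>x. dx u t x * cnj (nonlin t x))"
    by (rule Bochner_Integration.integrable_bound[OF integrable_mult_right[OF integrable_norm[OF integrable_nonlin[OF t]], of C]])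
       (use t in \<open>auto simp: norm_mult abs_mult intro!: mult_right_mono order_trans[OF C(5) abs_ge_self]\<close>)
  have contN: "isCont (nonlin t) x" for x
  proof -
    have "isCont (\<lambda>x. cmod (u t x) powr (2 * \<sigma>)) x"
      using isCont_u[OF t, of x] \<sigma> unfolding isCont_def
      by (intro tendsto_powr' tendsto_intros) auto
    then show ?thesis unfolding nonlin_def[abs_def]
      using isCont_u[OF t, of x] by (intro continuous_mult continuous_of_real)
  qed
  have "(LINT x|lborel. ?f x) = 0"
  proof (rule integral_derivative_eq_0[where F = "\<lambda>x. (cmod (u t x))\<^sup>2 powr (\<sigma> + 1)"])
    show "((\<lambda>x. (cmod (u t x))\<^sup>2 powr (\<sigma> + 1)) has_vector_derivative ?f x) (at x)" for x
      unfolding has_real_derivative_iff_has_vector_derivative[symmetric] nonlin_def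
      by (rule DERIV_potential, rule has_vector_derivative_dx[OF t])
    show "isCont ?f x" for x
      using contN[of x] isCont_dx[OF t, of x] unfolding isCont_def by (intro tendsto_intros)
    show "integrable lborel ?f"
      using integrable_Re[OF i] by (rule integrable_mult_right)
  qed (intro lim tendsto_weight C)+
  then show ?thesis using \<sigma> by simp
qed

text \<open>For the symbol \<open>1\<close> the spatial integral has the integrand \<open>u * cnj (nonlin)\<close>, a real function.\<close>

lemma spectral_mass_stationary:
  assumes t: "0 < t"
  shows "((\<lambda>\<tau>. LINT \<xi>|lborel. 1 * (cmod (fourier (u \<tau>) \<xi>))\<^sup>2) has_real_derivative 0) (at t)"
proof -
  have "u t x * cnj (nonlin t x) = complex_of_real (cmod (u t x) powr (2 * \<sigma>) * (cmod (u t x))\<^sup>2)" for x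
    by (simp only: nonlin_def complex_cnj_mult complex_cnj_complex_of_real of_real_mult complex_norm_square mult_ac)
  then have "Im (LINT x|lborel. u t x * cnj (nonlin t x)) = 0"
    by (simp only: integral_complex_of_real Im_complex_of_real)
  then show ?thesis
    using spectral_derivative(2)[OF t symbol_of_order_1] by (simp add: fourier_multiplier_1[OF t])
qed

text \<open>The symbol \<open>\<xi>\<close> belongs to \<open>- \<i> \<partial>\<^sub>x\<close>, so the balance is the integral of a total derivative.\<close>

lemma spectral_momentum_stationary:
  assumes t: "0 < t"
  shows "((\<lambda>\<tau>. LINT \<xi>|lborel. \<xi> * (cmod (fourier (u \<tau>) \<xi>))\<^sup>2) has_real_derivative 0) (at t)"
proof -
  obtain C where C: "\<And>x. cmod (dx u t x) \<le> C"
    by (rule bound_at[OF t]) blast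
  have i: "integrable lborel (\<lambda>x. - \<i> * dx u t x * cnj (nonlin t x))"
    by (rule Bochner_Integration.integrable_bound[OF integrable_mult_right[OF integrable_norm[OF integrable_nonlin[OF t]], of C]])
       (use t in \<open>auto simp: norm_mult abs_mult intro!: mult_right_mono order_trans[OF C abs_ge_self]\<close>)
  have "Im (- \<i> * dx u t x * cnj (nonlin t x)) = - Re (dx u t x * cnj (nonlin t x))" for x
    by (simp add: algebra_simps)
  then have "Im (LINT x|lborel. - \<i> * dx u t x * cnj (nonlin t x)) = 0"
    using integral_dx_nonlin[OF t] by (simp only: integral_Im[OF i, symmetric] Bochner_Integration.integral_minus minus_zero)
  then show ?thesis
    using spectral_derivative(2)[OF t symbol_of_order_id] unfolding fourier_multiplier_id[OF t] by simp
qed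

text \<open>For the symbol of the equation, \<open>(-\<partial>\<^sub>x\<^sub>x)\<^sup>s u\<close> may be replaced by \<open>\<i> u\<^sub>t + N\<close> with \<open>N = |u|\<^sup>2\<^sup>\<sigma> u\<close>.
The term \<open>N * cnj N\<close> is real, and what is left is the rate of change of the potential energy.\<close>

lemma spectral_kinetic_derivative:
  assumes t: "0 < t"
  shows "((\<lambda>\<tau>. LINT \<xi>|lborel. \<bar>\<xi>\<bar> powr (2 * s) * (cmod (fourier (u \<tau>) \<xi>))\<^sup>2) has_real_derivative
     4 * pi * (LINT x|lborel. Re (dt u t x * cnj (nonlin t x)))) (at t)"
proof -
  obtain C where C: "\<And>x. cmod (u t x) \<le> C" by (rule bound_at[OF t]) blast
  let ?h = "\<lambda>x. (\<i> * dt u t x + nonlin t x) * cnj (nonlin t x)"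
  have N: "cmod (nonlin t x) \<le> C powr (2 * \<sigma>) * C" for x
    using nonlin_le[OF C] mult_left_mono[OF C, of "C powr (2 * \<sigma>)"] order_trans by fastforce
  have i: "integrable lborel (\<lambda>x. \<i> * dt u t x + nonlin t x)"
    using fourier_dt(1)[OF t] integrable_nonlin[OF t] by (intro Bochner_Integration.integrable_add integrable_mult_right)
  have h: "integrable lborel ?h"
    by (rule Bochner_Integration.integrable_bound[OF integrable_mult_right[OF integrable_norm[OF i], of "C powr (2 * \<sigma>) * C"]])
       (use i t in \<open>auto simp: norm_mult abs_mult mult.commute[of "_ * C"] intro!: mult_left_mono order_trans[OF N]\<close>)
  have "Im (?h x) = Re (dt u t x * cnj (nonlin t x))" for x
    by (simp add: algebra_simps)
  then have "Im (LINT x|lborel. ?h x) = (LINT x|lborel. Re (dt u t x * cnj (nonlin t x)))"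
    by (simp only: integral_Im[OF h, symmetric])
  moreover have "symbol_of_order (2 * s) (\<lambda>\<xi>. \<bar>\<xi>\<bar> powr (2 * s))" "2 * s < 2"
    using symbol_of_order_powr[of "2 * s"] s by auto
  note spectral_derivative(2)[OF t this]
  ultimately show ?thesis
    unfolding frac_laplacian_def[symmetric] frac_laplacian_u[OF t] by simp
qed

lemma spectral_energy_stationary:
  assumes t: "0 < t"
  shows "((\<lambda>\<tau>. 1 / (4 * pi) * (LINT \<xi>|lborel. \<bar>\<xi>\<bar> powr (2 * s) * (cmod (fourier (u \<tau>) \<xi>))\<^sup>2)
      - 1 / (2 * \<sigma> + 2) * (LINT x|lborel. (cmod (u \<tau> x))\<^sup>2 powr (\<sigma> + 1))) has_real_derivative 0) (at t)"
proof (rule DERIV_cong[OF DERIV_diff[OF DERIV_cmult[OF spectral_kinetic_derivative[OF t]] DERIV_cmult[OF potential_derivative_dt[OF t]]]])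
  show "1 / (4 * pi) * (4 * pi * (LINT x|lborel. Re (dt u t x * cnj (nonlin t x))))
      - 1 / (2 * \<sigma> + 2) * ((2 * \<sigma> + 2) * (LINT x|lborel. Re (dt u t x * cnj (nonlin t x)))) = 0"
    using \<sigma> by simp
qed

end

theorem lemma2p1:
  fixes s \<sigma> :: real and u :: "real \<Rightarrow> real \<Rightarrow> complex" and v w :: "real \<Rightarrow> real \<Rightarrow> real"
  assumes "0 < s" and "s < 1" and "\<sigma> > 0"
    and u: "\<And>t x. u t x = complex_of_real (v t x) + \<i> * complex_of_real (w t x)"
    and "sufficiently_smooth u"
    and "sufficiently_decaying u"
    and "fnls_solution s \<sigma> u"
  shows "(\<forall>t>0. integrable lborel (mass_density (v t) (w t))
              \<and> integrable lborel (momentum_density (v t) (w t))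
              \<and> integrable lborel (energy_density s \<sigma> (v t) (w t))
              \<and> mass (v t) (w t) = 1 / 2 * (LINT x|lborel. (cmod (u t x))\<^sup>2)
              \<and> momentum (v t) (w t) = 1 / 2 * (LINT x|lborel. Im (cnj (u t x) * dx u t x)))
       \<and> (\<forall>t1>0. \<forall>t2>0. mass (v t1) (w t1) = mass (v t2) (w t2)
              \<and> momentum (v t1) (w t1) = momentum (v t2) (w t2)
              \<and> energy s \<sigma> (v t1) (w t1) = energy s \<sigma> (v t2) (w t2))"
proof -
  interpret fnls s \<sigma> u
    using assms by unfold_locales
  let ?D = "\<lambda>t x. fourier_multiplier (\<lambda>\<xi>. \<bar>\<xi>\<bar> powr s) (u t) x"
  let ?M = "\<lambda>t. LINT \<xi>|lborel. 1 * (cmod (fourier (u t) \<xi>))\<^sup>2"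
  let ?P = "\<lambda>t. LINT \<xi>|lborel. \<xi> * (cmod (fourier (u t) \<xi>))\<^sup>2"
  let ?E = "\<lambda>t. 1 / (4 * pi) * (LINT \<xi>|lborel. \<bar>\<xi>\<bar> powr (2 * s) * (cmod (fourier (u t) \<xi>))\<^sup>2)
      - 1 / (2 * \<sigma> + 2) * (LINT x|lborel. (cmod (u t x))\<^sup>2 powr (\<sigma> + 1))"
  have vw: "v t = (\<lambda>x. Re (u t x))" "w t = (\<lambda>x. Im (u t x))" for t
    by (simp_all add: u fun_eq_iff)
  have mass_density: "mass_density (v t) (w t) = (\<lambda>x. (cmod (u t x))\<^sup>2)" for t
    by (simp add: fun_eq_iff mass_density_def vw cmod_power2)
  have momentum_density: "momentum_density (v t) (w t) = (\<lambda>x. Im (cnj (u t x) * dx u t x))" if t: "0 < t" for t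
  proof
    fix x
    have "((\<lambda>x. Re (u t x)) has_real_derivative Re (dx u t x)) (at x)"
      "((\<lambda>x. Im (u t x)) has_real_derivative Im (dx u t x)) (at x)"
      using has_vector_derivative_dx[OF t, of x] by (simp_all only: has_vector_derivative_complex_iff)
    then have "deriv (v t) x = Re (dx u t x)" "deriv (w t) x = Im (dx u t x)"
      by (simp_all only: vw DERIV_imp_deriv)
    then show "momentum_density (v t) (w t) x = Im (cnj (u t x) * dx u t x)"
      unfolding momentum_density_def by (simp add: vw)
  qed
  have energy_density: "energy_density s \<sigma> (v t) (w t)
      = (\<lambda>x. 1 / 2 * (cmod (?D t x))\<^sup>2 - 1 / (2 * \<sigma> + 2) * (cmod (u t x))\<^sup>2 powr (\<sigma> + 1))" if t: "0 < t" for t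
  proof
    fix x
    have "integrable lborel (\<lambda>\<xi>. complex_of_real (\<bar>\<xi>\<bar> powr s) * fourier (u t) \<xi>)"
      using symbol_fourier(1)[OF t symbol_of_order_powr[of s]] assms(1,2) by simp
    then have "?D t x = abs_D s (v t) x + \<i> * abs_D s (w t) x"
      unfolding of_real_abs_D vw by (rule fourier_multiplier_Re_Im[OF integrable_u[OF t]]) simp
    then have "(cmod (?D t x))\<^sup>2 = (abs_D s (v t) x)\<^sup>2 + (abs_D s (w t) x)\<^sup>2"
      by (simp only: cmod_power2) simp
    then show "energy_density s \<sigma> (v t) (w t) x
        = 1 / 2 * (cmod (?D t x))\<^sup>2 - 1 / (2 * \<sigma> + 2) * (cmod (u t x))\<^sup>2 powr (\<sigma> + 1)"
      by (simp only: energy_density_def vw cmod_power2)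
  qed
  have int: "integrable lborel (\<lambda>x. 1 / 2 * (cmod (?D t x))\<^sup>2)"
    "integrable lborel (\<lambda>x. 1 / (2 * \<sigma> + 2) * (cmod (u t x))\<^sup>2 powr (\<sigma> + 1))" if t: "0 < t" for t
    using kinetic_spectral(1)[OF t] integrable_potential[OF t] by (auto intro!: integrable_mult_right)
  have mass_eq: "mass (v t) (w t) = 1 / (4 * pi) * ?M t" if t: "0 < t" for t
    unfolding mass_def mass_density integrable_norm_square(2)[OF t] by simp
  have momentum_eq: "momentum (v t) (w t) = 1 / (4 * pi) * ?P t" if t: "0 < t" for t
    unfolding momentum_def momentum_density[OF t] momentum_spectral(2)[OF t] by simp
  have energy_eq: "energy s \<sigma> (v t) (w t) = ?E t" if t: "0 < t" for t
    unfolding energy_def energy_density[OF t] Bochner_Integration.integral_diff[OF int[OF t]]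
      integral_mult_right_zero kinetic_spectral(2)[OF t] by simp
  have "mass (v t1) (w t1) = mass (v t2) (w t2) \<and> momentum (v t1) (w t1) = momentum (v t2) (w t2)
      \<and> energy s \<sigma> (v t1) (w t1) = energy s \<sigma> (v t2) (w t2)" if "0 < t1" "0 < t2" for t1 t2
    unfolding mass_eq[OF that(1)] mass_eq[OF that(2)] momentum_eq[OF that(1)] momentum_eq[OF that(2)]
      energy_eq[OF that(1)] energy_eq[OF that(2)]
    using eq_of_stationary[of ?M, OF spectral_mass_stationary that]
      eq_of_stationary[of ?P, OF spectral_momentum_stationary that]
      eq_of_stationary[of ?E, OF spectral_energy_stationary that] by (simp only:)
  moreover have "integrable lborel (mass_density (v t) (w t)) \<and> integrable lborel (momentum_density (v t) (w t))
      \<and> integrable lborel (energy_density s \<sigma> (v t) (w t))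
      \<and> mass (v t) (w t) = 1 / 2 * (LINT x|lborel. (cmod (u t x))\<^sup>2)
      \<and> momentum (v t) (w t) = 1 / 2 * (LINT x|lborel. Im (cnj (u t x) * dx u t x))" if t: "0 < t" for t
    unfolding mass_def momentum_def mass_density momentum_density[OF t] energy_density[OF t]
    using integrable_norm_square(1)[OF t] momentum_spectral(1)[OF t] Bochner_Integration.integrable_diff[OF int[OF t]]
    by blast
  ultimately show ?thesis by blast
qed

end
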